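(* Let $i\in\{1,2,3,4\}$ and consider the map $F_i$, with $a>1$ if $i\in\{1,2,3\}$ and $a<-1$ if $i=4$, and with $b=b^*(a)$. Then the set $$A=\{\theta\in\mathbb T\mid \lambda_\infty(\theta)=0\}$$ is residual in $\mathbb T$ and has zero Lebesgue measure. Additionally, $A$ contains a residual set $R$ which is positively and negatively invariant under the rotation $\theta\mapsto\theta+\omega$.
   Context: Maps. $\mathbb T=\mathbb R/2\pi\mathbb Z$, $\omega\notin 2\pi\mathbb Q$, and $g:\mathbb T\to\mathbb R$ is of class $C^{1+\tau}$ for some $\tau>0$. For $i=1,2,3,4$, $F_i:\mathbb R\times\mathbb T\to\mathbb R\times\mathbb T$ is $F_i(x,\theta)=(h_i(x)+\sigma_i b\,g(\theta),\ \theta+\omega)$ with $\sigma_1=\sigma_4=-1$, $\sigma_2=\sigma_3=1$, and - $h_1(x)=-\frac{\pi}{2}$ if $x<-\frac{\pi}{2a}$, $h_1(x)=ax$ if $|x|\le\frac{\pi}{2a}$, $h_1(x)=\frac{\pi}{2}$ if $x>\frac{\pi}{2a}$; - $h_2(x)=a(x+\delta)$ if $x<-\delta$, $h_2(x)=0$ if $|x|\le\delta$, $h_2(x)=a(x-\delta)$ if $x>\delta$ (here $\delta>0$ is fixed); - $h_3(x)=ax$ if $x>-\frac1a$, $h_3(x)=-1$ if $x\le-\frac1a$; - $h_4(x)=ax$ if $x>\frac1a$, $h_4(x)=1$ if $x\le\frac1a$. Put $\mathcal F_i(\varphi)(\theta)=h_i(\varphi(\theta-\omega))+\sigma_i b\,g(\theta-\omega)$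 for $\varphi:\mathbb T\to\mathbb R$. Curves. $\mu_i$ is the continuous solution of: $\mu_1(\theta+\omega)=a\mu_1(\theta)-bg(\theta)$; $\mu_2(\theta+\omega)=a(\mu_2(\theta)-\delta)+bg(\theta)$; $\mu_3(\theta+\omega)=a\mu_3(\theta)+bg(\theta)$; $\mu_4(\theta+\omega)=a\mu_4(\theta)-bg(\theta)$. Also $\hat\mu_2$ is the continuous solution of $\hat\mu_2(\theta+\omega)=a(\hat\mu_2(\theta)+\delta)+bg(\theta)$ and $\tilde\gamma_1(\theta)=-\frac\pi2-bg(\theta-\omega)$. The initial curve $\varphi_0$ is: $\frac\pi2-bg(\theta-\omega)$ for $i=1$; $bg(\theta-\omega)$ for $i=2$; $-1+bg(\theta-\omega)$ for $i=3$; $1-bg(\theta-\omega)$ for $i=4$. For $n\ge0$, $\varphi_{n+1}=\mathcal F_i(\varphi_n)$ if $i=1,2,3$ and $\varphi_{n+1}=\mathcal F_4^2(\varphi_n)$ if $i=4$; $\varphi_\infty=\lim_n\varphi_n$ (pointwise). Put $\lambda_n=\varphi_n-\mu_i$ if $i=1,4$, $\lambda_n=\mu_i-\varphi_n$ if $i=2,3$, and $\lambda_\infty=\lim_n\lambda_n$. Bifurcation value. $b^*(a)$ (assumed to exist) is the smallest $b>0$ for which the following graphs meet: for $i=1$, the graph of $\mu_1$ and the graph of $\varphi_0$ or of $\tilde\gamma_1$; for $i=2$, the graph of $\varphi_0$ and the graph of $\mu_2$ or of $\hat\mu_2$; for $i=3,4$, the graphs of $\varphi_0$ and $\mu_i$.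 Standing assumptions at $b=b^*(a)$. The set $Z_{\lambda_0}=\{\theta\in\mathbb T\mid\lambda_0(\theta)=0\}$ is nonempty, and at least one of the following holds: (A) $g$ is analytic; (B) for every $\theta_0\in Z_{\lambda_0}$ there exist $\varepsilon>0$ and an even integer $m>0$ such that $\lambda_0(\theta)=(\theta-\theta_0)^m q(\theta)$ for $\theta\in(\theta_0-\varepsilon,\theta_0+\varepsilon)$, with $q>0$ on this interval.
   Formalization: Assumes in addition that g is not constant (otherwise A is all of T), that for i=2 the pointwise limit of φ_n exists at every θ (it can fail, e.g. for g = sin), and that q in (B) is continuous (otherwise flat zeros qualify and zero measure can fail). *)

theory Defs
  imports "HOL-Analysis.Analysis" "HOL-Library.Periodic_Fun"
begin

text \<open>
  The circle \<open>\<real>/2\<pi>\<int>\<close> is handled through lifts: functions on it are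
  \<open>2\<pi>\<close>-periodic functions on the reals, and subsets, open sets and dense sets of
  it are their \<open>2\<pi>\<close>-periodic preimages under the projection.
\<close>

abbreviation circle_fun :: "(real \<Rightarrow> real) \<Rightarrow> bool" where
  "circle_fun f \<equiv> periodic_fun_simple f (2 * pi)"

abbreviation circle_set :: "real set \<Rightarrow> bool" where
  "circle_set S \<equiv> periodic_fun_simple (\<lambda>\<theta>. \<theta> \<in> S) (2 * pi)"

text \<open>The projection is open and continuous, so the open dense subsets of the circle
  correspond exactly to the open dense periodic subsets of the reals.\<close>

definition residual_circle :: "real set \<Rightarrow> bool" where
  "residual_circle S \<longleftrightarrow> circle_set S \<and>
     (\<exists>U :: nat \<Rightarrow> real set.
        (\<forall>n. circle_set (U n) \<and> open (U n) \<and> closure (U n) = UNIV) \<and> (\<Inter>n. U n) \<subseteq> S)"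

definition null_circle :: "real set \<Rightarrow> bool" where
  "null_circle S \<longleftrightarrow> circle_set S \<and> S \<inter> {0..<2 * pi} \<in> null_sets lebesgue"

text \<open>Class \<open>C\<^sup>1\<^sup>+\<^sup>\<tau>\<close> for some \<open>\<tau> > 0\<close>. On the compact circle these classes
  decrease in \<open>\<tau>\<close>, so only Hoelder exponents at most 1 need be considered (an exponent
  above 1 in the inequality would force the derivative to be constant).\<close>

definition C1_Hoelder :: "(real \<Rightarrow> real) \<Rightarrow> bool" where
  "C1_Hoelder g \<longleftrightarrow>
     (\<exists>\<tau> C g'. 0 < \<tau> \<and> \<tau> \<le> 1 \<and>
        (\<forall>\<theta>. (g has_real_derivative g' \<theta>) (at \<theta>)) \<and>
        (\<forall>\<theta> \<eta>. \<bar>g' \<theta> - g' \<eta>\<bar> \<le> C * \<bar>\<theta> - \<eta>\<bar> powr \<tau>))"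

definition real_analytic :: "(real \<Rightarrow> real) \<Rightarrow> bool" where
  "real_analytic g \<longleftrightarrow>
     (\<forall>\<theta>\<^sub>0. \<exists>\<epsilon>>0. \<exists>c :: nat \<Rightarrow> real.
        \<forall>\<theta>. \<bar>\<theta> - \<theta>\<^sub>0\<bar> < \<epsilon> \<longrightarrow> (\<lambda>n. c n * (\<theta> - \<theta>\<^sub>0) ^ n) sums g \<theta>)"

definition h1 :: "real \<Rightarrow> real \<Rightarrow> real" where
  "h1 a x = (if x < - (pi / (2 * a)) then - (pi / 2)
             else if x \<le> pi / (2 * a) then a * x else pi / 2)"

definition h2 :: "real \<Rightarrow> real \<Rightarrow> real \<Rightarrow> real" where
  "h2 a \<delta> x = (if x < - \<delta> then a * (x + \<delta>)
               else if x \<le> \<delta> then 0 else a * (x - \<delta>))"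

definition h3 :: "real \<Rightarrow> real \<Rightarrow> real" where
  "h3 a x = (if x > - (1 / a) then a * x else -1)"

definition h4 :: "real \<Rightarrow> real \<Rightarrow> real" where
  "h4 a x = (if x > 1 / a then a * x else 1)"

text \<open>In everything below the index \<open>i\<close> ranges over \<open>{1, 2, 3, 4}\<close>; the last branch
  of each case distinction is the one for \<open>i = 4\<close>.\<close>

definition h :: "nat \<Rightarrow> real \<Rightarrow> real \<Rightarrow> real \<Rightarrow> real" where
  "h i a \<delta> = (if i = 1 then h1 a else if i = 2 then h2 a \<delta> else if i = 3 then h3 a else h4 a)"

definition sgm :: "nat \<Rightarrow> real" where
  "sgm i = (if i = 2 \<or> i = 3 then 1 else -1)"

definition skew_map ::
  "nat \<Rightarrow> real \<Rightarrow> real \<Rightarrow> real \<Rightarrow> (real \<Rightarrow> real) \<Rightarrow> real \<Rightarrow> real \<times> real \<Rightarrow> real \<times> real" where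
  "skew_map i a \<delta> \<omega> g b = (\<lambda>(x, \<theta>). (h i a \<delta> x + sgm i * b * g \<theta>, \<theta> + \<omega>))"

definition graph_transform ::
  "nat \<Rightarrow> real \<Rightarrow> real \<Rightarrow> real \<Rightarrow> (real \<Rightarrow> real) \<Rightarrow> real \<Rightarrow> (real \<Rightarrow> real) \<Rightarrow> real \<Rightarrow> real" where
  "graph_transform i a \<delta> \<omega> g b \<phi> \<theta> = fst (skew_map i a \<delta> \<omega> g b (\<phi> (\<theta> - \<omega>), \<theta> - \<omega>))"

text \<open>The continuous solution on the circle of \<open>u(\<theta> + \<omega>) = s \<theta> (u \<theta>)\<close>. It exists and
  is unique for the expanding affine \<open>s\<close> (slope \<open>a\<close> with \<open>\<bar>a\<bar> > 1\<close>) used here.\<close>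

definition cont_solution :: "real \<Rightarrow> (real \<Rightarrow> real \<Rightarrow> real) \<Rightarrow> real \<Rightarrow> real" where
  "cont_solution \<omega> s =
     (THE u. circle_fun u \<and> continuous_on UNIV u \<and> (\<forall>\<theta>. u (\<theta> + \<omega>) = s \<theta> (u \<theta>)))"

definition mu :: "nat \<Rightarrow> real \<Rightarrow> real \<Rightarrow> real \<Rightarrow> (real \<Rightarrow> real) \<Rightarrow> real \<Rightarrow> real \<Rightarrow> real" where
  "mu i a \<delta> \<omega> g b =
     cont_solution \<omega> (\<lambda>\<theta> x. (if i = 2 then a * (x - \<delta>) else a * x) + sgm i * b * g \<theta>)"

definition mu_hat2 :: "real \<Rightarrow> real \<Rightarrow> real \<Rightarrow> (real \<Rightarrow> real) \<Rightarrow> real \<Rightarrow> real \<Rightarrow> real" where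
  "mu_hat2 a \<delta> \<omega> g b = cont_solution \<omega> (\<lambda>\<theta> x. a * (x + \<delta>) + b * g \<theta>)"

definition gamma_tilde1 :: "real \<Rightarrow> (real \<Rightarrow> real) \<Rightarrow> real \<Rightarrow> real \<Rightarrow> real" where
  "gamma_tilde1 \<omega> g b \<theta> = - (pi / 2) - b * g (\<theta> - \<omega>)"

definition phi0 :: "nat \<Rightarrow> real \<Rightarrow> (real \<Rightarrow> real) \<Rightarrow> real \<Rightarrow> real \<Rightarrow> real" where
  "phi0 i \<omega> g b \<theta> =
     (if i = 1 then pi / 2 - b * g (\<theta> - \<omega>)
      else if i = 2 then b * g (\<theta> - \<omega>)
      else if i = 3 then -1 + b * g (\<theta> - \<omega>)
      else 1 - b * g (\<theta> - \<omega>))"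

primrec phi ::
  "nat \<Rightarrow> real \<Rightarrow> real \<Rightarrow> real \<Rightarrow> (real \<Rightarrow> real) \<Rightarrow> real \<Rightarrow> nat \<Rightarrow> real \<Rightarrow> real" where
  "phi i a \<delta> \<omega> g b 0 = phi0 i \<omega> g b"
| "phi i a \<delta> \<omega> g b (Suc n) =
     (if i = 4
      then graph_transform i a \<delta> \<omega> g b (graph_transform i a \<delta> \<omega> g b (phi i a \<delta> \<omega> g b n))
      else graph_transform i a \<delta> \<omega> g b (phi i a \<delta> \<omega> g b n))"

definition lam ::
  "nat \<Rightarrow> real \<Rightarrow> real \<Rightarrow> real \<Rightarrow> (real \<Rightarrow> real) \<Rightarrow> real \<Rightarrow> nat \<Rightarrow> real \<Rightarrow> real" where
  "lam i a \<delta> \<omega> g b n \<theta> =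
     (if i = 2 \<or> i = 3 then mu i a \<delta> \<omega> g b \<theta> - phi i a \<delta> \<omega> g b n \<theta>
      else phi i a \<delta> \<omega> g b n \<theta> - mu i a \<delta> \<omega> g b \<theta>)"

definition lam_inf ::
  "nat \<Rightarrow> real \<Rightarrow> real \<Rightarrow> real \<Rightarrow> (real \<Rightarrow> real) \<Rightarrow> real \<Rightarrow> real \<Rightarrow> real" where
  "lam_inf i a \<delta> \<omega> g b \<theta> = lim (\<lambda>n. lam i a \<delta> \<omega> g b n \<theta>)"

definition graphs_meet :: "(real \<Rightarrow> real) \<Rightarrow> (real \<Rightarrow> real) \<Rightarrow> bool" where
  "graphs_meet u v \<longleftrightarrow> (\<exists>\<theta>. u \<theta> = v \<theta>)"

definition bif_meet :: "nat \<Rightarrow> real \<Rightarrow> real \<Rightarrow> real \<Rightarrow> (real \<Rightarrow> real) \<Rightarrow> real \<Rightarrow> bool" where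
  "bif_meet i a \<delta> \<omega> g b \<longleftrightarrow>
     graphs_meet (phi0 i \<omega> g b) (mu i a \<delta> \<omega> g b) \<or>
     i = 1 \<and> graphs_meet (gamma_tilde1 \<omega> g b) (mu i a \<delta> \<omega> g b) \<or>
     i = 2 \<and> graphs_meet (phi0 i \<omega> g b) (mu_hat2 a \<delta> \<omega> g b)"

definition bifurcation_value ::
  "nat \<Rightarrow> real \<Rightarrow> real \<Rightarrow> real \<Rightarrow> (real \<Rightarrow> real) \<Rightarrow> real \<Rightarrow> bool" where
  "bifurcation_value i a \<delta> \<omega> g b \<longleftrightarrow>
     0 < b \<and> bif_meet i a \<delta> \<omega> g b \<and> (\<forall>b'. 0 < b' \<and> bif_meet i a \<delta> \<omega> g b' \<longrightarrow> b \<le> b')"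

definition zero_set :: "(real \<Rightarrow> real) \<Rightarrow> real set" where
  "zero_set l = {\<theta>. l \<theta> = 0}"

text \<open>The cofactor \<open>q\<close> has to be continuous (off \<open>\<theta>\<^sub>0\<close> this is automatic for continuous
  \<open>l\<close>): otherwise its value at \<open>\<theta>\<^sub>0\<close> is arbitrary, and every zero at which \<open>l\<close> is locally
  positive on both sides, flat ones included, would qualify.\<close>

definition even_order_zeros :: "(real \<Rightarrow> real) \<Rightarrow> bool" where
  "even_order_zeros l \<longleftrightarrow>
     (\<forall>\<theta>\<^sub>0 \<in> zero_set l. \<exists>\<epsilon>>0. \<exists>m::nat. \<exists>q :: real \<Rightarrow> real.
        even m \<and> 0 < m \<and> continuous_on {\<theta>\<^sub>0 - \<epsilon><..<\<theta>\<^sub>0 + \<epsilon>} q \<and>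
        (\<forall>\<theta> \<in> {\<theta>\<^sub>0 - \<epsilon><..<\<theta>\<^sub>0 + \<epsilon>}. l \<theta> = (\<theta> - \<theta>\<^sub>0) ^ m * q \<theta> \<and> 0 < q \<theta>))"

end

theory Submission
  imports Defs "HOL-Complex_Analysis.Complex_Analysis"
begin

text \<open>
  Let \<open>N\<close> be the continuous solution of \<open>N(\<theta> + \<omega>) = a N(\<theta>) + g(\<theta>)\<close>. Then \<open>\<mu>\<^sub>i\<close> is a
  constant plus or minus \<open>b N\<close>, and \<open>\<lambda>\<^sub>0(\<theta>) = K + a b N(\<theta> - \<omega>)\<close> with a constant \<open>K > 0\<close>, so
  minimality of \<open>b\<close> gives \<open>\<lambda>\<^sub>0 \<ge> 0\<close>. Put \<open>\<alpha> = a\<close>, \<open>\<rho> = \<omega>\<close> for \<open>i \<noteq> 4\<close> and \<open>\<alpha> = a\<^sup>2\<close>,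
  \<open>\<rho> = 2 \<omega>\<close> for \<open>i = 4\<close>. In every case
  \<open>\<lambda>\<^sub>n\<^sub>+\<^sub>1(\<theta> + \<rho>) \<ge> min (\<alpha> \<lambda>\<^sub>n(\<theta>)) (\<lambda>\<^sub>0(\<theta> + \<rho>))\<close>, with equality unless \<open>i = 2\<close>, where the
  curves may drop below the dead zone; also zeros are transported, \<open>\<lambda>\<^sub>n(\<zeta> + n \<rho>) = 0\<close> if
  \<open>\<lambda>\<^sub>0(\<zeta>) = 0\<close>.

  Residuality: the points \<open>\<zeta> + n \<rho>\<close> with \<open>n \<ge> m\<close> are dense, so the set where
  \<open>\<lambda>\<^sub>n < 1 / (m + 1)\<close> for some \<open>n \<ge> m\<close> is open and dense. On the intersection over \<open>m\<close> a
  subsequence of \<open>\<lambda>\<^sub>n\<close> tends to \<open>0\<close>, hence so does the convergent sequence itself.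

  Measure zero: \<open>\<lambda>\<^sub>\<infinity>(\<theta>) \<ge> inf\<^sub>k \<alpha>\<^sup>k \<lambda>\<^sub>0(\<theta> - k \<rho>)\<close>. As the zeros of \<open>\<lambda>\<^sub>0\<close> have finite order,
  the sublevel sets \<open>{\<lambda>\<^sub>0 < \<alpha>\<^sup>-\<^sup>k}\<close> have summable measure, and by Borel--Cantelli this infimum is
  positive almost everywhere. For analytic \<open>g\<close> the series for \<open>N\<close> extends holomorphically to a
  strip around the reals, so that \<open>\<lambda>\<^sub>0\<close> has zeros of finite order too.
\<close>

section \<open>Rotations of the circle\<close>

lemma circle_fun_int: "circle_fun f \<Longrightarrow> f (x + of_int j * (2 * pi)) = f x"
proof -
  assume "circle_fun f"
  then interpret periodic_fun_simple f "2 * pi" .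
  show ?thesis by (rule plus_of_int)
qed

lemma circle_fun_reduce:
  obtains j :: int where "x + of_int j * (2 * pi) \<in> {0..<2 * pi}"
proof
  let ?j = "- \<lfloor>x / (2 * pi)\<rfloor>"
  have "of_int \<lfloor>x / (2 * pi)\<rfloor> \<le> x / (2 * pi)" "x / (2 * pi) < of_int \<lfloor>x / (2 * pi)\<rfloor> + 1"
    by linarith+
  then have "of_int \<lfloor>x / (2 * pi)\<rfloor> * (2 * pi) \<le> x" "x < (of_int \<lfloor>x / (2 * pi)\<rfloor> + 1) * (2 * pi)"
    by (simp_all only: pos_le_divide_eq pos_divide_less_eq pi_gt_zero mult_pos_pos zero_less_numeral)
  then show "x + of_int ?j * (2 * pi) \<in> {0..<2 * pi}"
    by (simp add: algebra_simps)
qed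

text \<open>A property inherited by subsets and by binary unions passes from small neighbourhoods to
  a compact set through a finite subcover. It serves twice: for summable sublevel sets and for a
  uniform radius of holomorphic extension.\<close>

lemma compact_local_to_global:
  assumes "compact S" and empty: "P {}"
    and Un: "\<And>U V. P U \<Longrightarrow> P V \<Longrightarrow> P (U \<union> V)"
    and mono: "\<And>U V. P V \<Longrightarrow> U \<subseteq> V \<Longrightarrow> P U"
    and loc: "\<And>x. x \<in> S \<Longrightarrow> \<exists>U. open U \<and> x \<in> U \<and> P U"
  shows "P S"
proof -
  obtain W where W: "\<And>x. x \<in> S \<Longrightarrow> open (W x) \<and> x \<in> W x \<and> P (W x)"
    using loc by metis
  obtain D where D: "D \<subseteq> S" "finite D" "S \<subseteq> (\<Union>x\<in>D. W x)"
    using compactE_image[OF \<open>compact S\<close>, of S W] W by blast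
  have "P (\<Union>x\<in>D. W x)"
    using D(2,1)
  proof (induction D)
    case empty
    then show ?case by (simp add: assms(2))
  next
    case (insert x D)
    then show ?case using W Un by auto
  qed
  then show ?thesis using mono D(3) by blast
qed

lemma rotation_orbit_dense:
  assumes irr: "\<omega> / (2 * pi) \<notin> \<rat>" and "e > 0"
  obtains n :: nat and j :: int
  where "n \<ge> m" "\<bar>\<zeta> + real n * \<omega> + of_int j * (2 * pi) - x\<bar> < e"
proof -
  \<comment> \<open>Kronecker's theorem is applied with the starting point moved ahead by
    \<open>m\<close> rotations. As \<open>k\<close> is positive, the time \<open>m + nat k\<close>
    is then at least \<open>m\<close>.\<close>
  obtain hh k where k: "k > 0"
    "\<bar>of_int k * (\<omega> / (2 * pi)) - of_int hh - (x - \<zeta> - real m * \<omega>) / (2 * pi)\<bar> < e / (2 * pi)"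
    using sequence_of_fractional_parts_is_dense[OF irr, of "e / (2 * pi)"
        "(x - \<zeta> - real m * \<omega>) / (2 * pi)"] \<open>e > 0\<close> by (metis divide_pos_pos pi_gt_zero mult_pos_pos zero_less_numeral)
  have eq: "\<zeta> + real (m + nat k) * \<omega> + of_int (- hh) * (2 * pi) - x =
      2 * pi * (of_int k * (\<omega> / (2 * pi)) - of_int hh - (x - \<zeta> - real m * \<omega>) / (2 * pi))"
    using k(1) by (simp add: field_simps)
  have "\<bar>\<zeta> + real (m + nat k) * \<omega> + of_int (- hh) * (2 * pi) - x\<bar> < 2 * pi * (e / (2 * pi))"
    unfolding eq abs_mult using mult_strict_left_mono[OF k(2), of "2 * pi"] by simp
  then show thesis by (intro that[of "m + nat k" "- hh"]) auto
qed

lemma residual_zero_set_lim: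
  assumes irr: "\<omega> / (2 * pi) \<notin> \<rat>"
    and per: "\<And>n. circle_fun (l n)"
    and cont: "\<And>n. continuous_on UNIV (l n :: real \<Rightarrow> real)"
    and zero: "\<And>n. l n (\<zeta> + real n * \<omega>) = 0"
    and conv: "\<And>\<theta>. convergent (\<lambda>n. l n \<theta>)"
  shows "residual_circle {\<theta>. lim (\<lambda>n. l n \<theta>) = 0}"
  unfolding residual_circle_def
proof (intro conjI exI allI)
  define U where "U m = (\<Union>n\<in>{m..}. {\<theta>. \<bar>l n \<theta>\<bar> < 1 / real (Suc m)})" for m :: nat
  show "circle_set {\<theta>. lim (\<lambda>n. l n \<theta>) = 0}"
    by (rule periodic_fun_simple.intro) (simp add: periodic_fun_simple.plus_period[OF per])
  fix m
  show "circle_set (U m)"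
    unfolding U_def by (rule periodic_fun_simple.intro) (simp add: periodic_fun_simple.plus_period[OF per])
  show "open (U m)"
    unfolding U_def by (intro open_UN ballI open_Collect_less continuous_intros cont)
  have "x \<in> closure (U m)" for x
    unfolding closure_approachable
  proof (intro allI impI)
    fix e :: real assume "e > 0"
    obtain n :: nat and j :: int
      where nj: "n \<ge> m" "\<bar>\<zeta> + real n * \<omega> + of_int j * (2 * pi) - x\<bar> < e"
      using rotation_orbit_dense[OF irr \<open>e > 0\<close>] .
    have "l n (\<zeta> + real n * \<omega> + of_int j * (2 * pi)) = 0"
      by (simp add: circle_fun_int[OF per] zero)
    then show "\<exists>y\<in>U m. dist y x < e"
      using nj unfolding U_def
      by (intro bexI[of _ "\<zeta> + real n * \<omega> + of_int j * (2 * pi)"])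
        (auto simp: dist_real_def intro!: bexI[of _ n])
  qed
  then show "closure (U m) = UNIV" by auto
next
  show "(\<Inter>m. \<Union>n\<in>{m..}. {\<theta>. \<bar>l n \<theta>\<bar> < 1 / real (Suc m)}) \<subseteq> {\<theta>. lim (\<lambda>n. l n \<theta>) = 0}"
  proof
    fix \<theta> assume "\<theta> \<in> (\<Inter>m. \<Union>n\<in>{m..}. {\<theta>. \<bar>l n \<theta>\<bar> < 1 / real (Suc m)})"
    then have "\<forall>m. \<exists>n\<ge>m. \<bar>l n \<theta>\<bar> < 1 / real (Suc m)" by auto
    then obtain s where s: "\<And>m. s m \<ge> m" "\<And>m. \<bar>l (s m) \<theta>\<bar> < 1 / real (Suc m)" by metis
    have "filterlim s sequentially sequentially"
      using s(1) by (intro filterlim_at_top_mono[OF filterlim_ident]) auto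
    then have "(\<lambda>m. l (s m) \<theta>) \<longlonglongrightarrow> lim (\<lambda>n. l n \<theta>)"
      using filterlim_compose conv convergent_LIMSEQ_iff by blast
    moreover have "(\<lambda>m. l (s m) \<theta>) \<longlonglongrightarrow> 0"
      by (rule Lim_null_comparison[OF _ lim_1_over_n[THEN LIMSEQ_Suc]])
        (use s(2) in \<open>auto intro!: always_eventually less_imp_le\<close>)
    ultimately show "\<theta> \<in> {\<theta>. lim (\<lambda>n. l n \<theta>) = 0}"
      using LIMSEQ_unique by blast
  qed
qed

text \<open>The points whose whole two-sided orbit stays in \<open>A\<close> form the intersection
  of all rotates of \<open>A\<close> by integer multiples of \<open>\<omega>\<close>. This set is
  invariant, and it is residual because only countably many rotates occur.\<close>

lemma residual_invariant_core:
  assumes "residual_circle A"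
  shows "\<exists>R. R \<subseteq> A \<and> residual_circle R \<and> (\<forall>\<theta>\<in>R. \<theta> + \<omega> \<in> R \<and> \<theta> - \<omega> \<in> R)"
proof (intro exI conjI ballI)
  let ?R = "{\<theta>. \<forall>j::int. \<theta> + of_int j * \<omega> \<in> A}"
  show "?R \<subseteq> A" by (auto dest: spec[of _ 0])
  from assms obtain U :: "nat \<Rightarrow> real set" where A: "circle_set A"
    and U: "\<And>n. circle_set (U n)" "\<And>n. open (U n)" "\<And>n. closure (U n) = UNIV" "(\<Inter>n. U n) \<subseteq> A"
    unfolding residual_circle_def by blast
  \<comment> \<open>The number \<open>p\<close> codes a pair of an integer \<open>j\<close> and an
    index \<open>m\<close>; \<open>V p\<close> is \<open>U m\<close> rotated by
    \<open>- j * \<omega>\<close>, hence again open and dense.\<close>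
  define V where "V p = (\<lambda>\<theta>. \<theta> - of_int (int_decode (fst (prod_decode p))) * \<omega>) ` U (snd (prod_decode p))" for p
  have V: "\<theta> \<in> V p \<longleftrightarrow> \<theta> + of_int (int_decode (fst (prod_decode p))) * \<omega> \<in> U (snd (prod_decode p))" for p \<theta>
    unfolding V_def by (force intro: image_eqI[where x = "\<theta> + _"])
  show "residual_circle ?R"
    unfolding residual_circle_def
  proof (intro conjI exI allI)
    show "circle_set ?R"
    proof (rule periodic_fun_simple.intro)
      fix x
      have "x + 2 * pi + of_int j * \<omega> \<in> A \<longleftrightarrow> x + of_int j * \<omega> \<in> A" for j :: int
        using periodic_fun_simple.plus_period[OF A, of "x + of_int j * \<omega>"] by (simp add: add_ac)
      then show "(x + 2 * pi \<in> ?R) = (x \<in> ?R)" by simp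
    qed
    fix p
    show "circle_set (V p)"
    proof (rule periodic_fun_simple.intro)
      fix x
      show "(x + 2 * pi \<in> V p) = (x \<in> V p)"
        unfolding V
        using periodic_fun_simple.plus_period[OF U(1), of "x + of_int (int_decode (fst (prod_decode p))) * \<omega>"]
        by (simp add: add_ac)
    qed
    show "open (V p)"
      unfolding V_def using open_translation_subtract[OF U(2)] by blast
    show "closure (V p) = UNIV"
      unfolding V_def closure_translation_subtract U(3) by (simp add: surj_diff_right)
  next
    show "(\<Inter>p. V p) \<subseteq> ?R"
    proof safe
      fix \<theta> and j :: int assume \<theta>: "\<theta> \<in> (\<Inter>p. V p)"
      have "\<theta> + of_int j * \<omega> \<in> U m" for m
        using \<theta> V[of \<theta> "prod_encode (int_encode j, m)"] by auto
      then show "\<theta> + of_int j * \<omega> \<in> A" using U(4) by blast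
    qed
  qed
  fix \<theta> assume \<theta>: "\<theta> \<in> ?R"
  have "\<theta> + \<omega> + of_int j * \<omega> \<in> A" "\<theta> - \<omega> + of_int j * \<omega> \<in> A" for j :: int
    using \<theta>[THEN CollectD, THEN spec, of "j + 1"] \<theta>[THEN CollectD, THEN spec, of "j - 1"]
    by (simp_all add: algebra_simps)
  then show "\<theta> + \<omega> \<in> ?R" "\<theta> - \<omega> \<in> ?R" by auto
qed

section \<open>Zeros of finite order and sublevel sets\<close>

text \<open>Common consequence of the two alternatives (A) and (B): a power lower bound near each
  zero. It is all that the measure estimate asks of the order, and it is blind to the sign and to
  parity.\<close>

definition finite_order_zeros :: "(real \<Rightarrow> real) \<Rightarrow> bool" where
  "finite_order_zeros l \<longleftrightarrow> (\<forall>\<zeta>. l \<zeta> = 0 \<longrightarrow>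
     (\<exists>(m::nat) c r. 0 < c \<and> 0 < r \<and> (\<forall>\<theta>. \<bar>\<theta> - \<zeta>\<bar> < r \<longrightarrow> c * \<bar>\<theta> - \<zeta>\<bar> ^ m \<le> \<bar>l \<theta>\<bar>)))"

text \<open>By continuity the cofactor stays above half of its positive value at the zero.\<close>

lemma finite_order_zerosI_even_order:
  assumes "even_order_zeros l"
  shows "finite_order_zeros l"
  unfolding finite_order_zeros_def
proof (intro allI impI)
  fix \<zeta> assume "l \<zeta> = 0"
  then obtain \<epsilon> m q where e: "\<epsilon> > 0" "even m" "continuous_on {\<zeta> - \<epsilon><..<\<zeta> + \<epsilon>} q"
    "\<And>\<theta>. \<theta> \<in> {\<zeta> - \<epsilon><..<\<zeta> + \<epsilon>} \<Longrightarrow> l \<theta> = (\<theta> - \<zeta>) ^ m * q \<theta> \<and> 0 < q \<theta>"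
    using assms unfolding even_order_zeros_def zero_set_def by blast
  have "isCont q \<zeta>" using e(1,3) by (simp add: continuous_on_eq_continuous_at)
  moreover have q: "q \<zeta> > 0" using e(1) e(4)[of \<zeta>] by simp
  ultimately obtain d where d: "d > 0" "\<And>\<theta>. \<bar>\<theta> - \<zeta>\<bar> < d \<Longrightarrow> \<bar>q \<theta> - q \<zeta>\<bar> < q \<zeta> / 2"
    unfolding continuous_at_eps_delta dist_real_def by (meson half_gt_zero)
  show "\<exists>(m::nat) c r. 0 < c \<and> 0 < r \<and> (\<forall>\<theta>. \<bar>\<theta> - \<zeta>\<bar> < r \<longrightarrow> c * \<bar>\<theta> - \<zeta>\<bar> ^ m \<le> \<bar>l \<theta>\<bar>)"
  proof (intro exI conjI allI impI)
    show "0 < q \<zeta> / 2" "0 < min d \<epsilon>" using q d e by auto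
    fix \<theta> assume \<theta>: "\<bar>\<theta> - \<zeta>\<bar> < min d \<epsilon>"
    then have "\<theta> \<in> {\<zeta> - \<epsilon><..<\<zeta> + \<epsilon>}" "\<bar>q \<theta> - q \<zeta>\<bar> < q \<zeta> / 2"
      using d(2) by auto
    then have "l \<theta> = (\<theta> - \<zeta>) ^ m * q \<theta>" "0 < q \<theta>" "q \<zeta> / 2 \<le> q \<theta>"
      using e(4) by (blast, blast, linarith)
    then have "q \<zeta> / 2 * \<bar>\<theta> - \<zeta>\<bar> ^ m \<le> q \<theta> * \<bar>\<theta> - \<zeta>\<bar> ^ m"
      by (intro mult_right_mono) auto
    also have "\<dots> = \<bar>l \<theta>\<bar>"
      using \<open>l \<theta> = _\<close> \<open>0 < q \<theta>\<close> by (simp add: abs_mult power_abs)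
    finally show "q \<zeta> / 2 * \<bar>\<theta> - \<zeta>\<bar> ^ m \<le> \<bar>l \<theta>\<bar>" .
  qed
qed

text \<open>The sublevel sets are only required to be covered by measurable sets \<open>E k\<close>,
  with a majorant \<open>s\<close> for their measures. So \<open>W\<close> may be arbitrary, and the
  property passes to subsets and unions at once.\<close>

definition summable_sublevels :: "(real \<Rightarrow> real) \<Rightarrow> real \<Rightarrow> real set \<Rightarrow> bool" where
  "summable_sublevels l \<alpha> W \<longleftrightarrow>
     (\<exists>E s. (\<forall>k. E k \<in> lmeasurable \<and> {\<theta> \<in> W. \<bar>l \<theta>\<bar> * \<alpha> ^ k < 1} \<subseteq> E k \<and> measure lebesgue (E k) \<le> s k)
        \<and> summable s)"

lemma summable_sublevels_Un:
  assumes "summable_sublevels l \<alpha> U" "summable_sublevels l \<alpha> V"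
  shows "summable_sublevels l \<alpha> (U \<union> V)"
proof -
  obtain E s E' s' where
    E: "\<And>k. E k \<in> lmeasurable \<and> {\<theta> \<in> U. \<bar>l \<theta>\<bar> * \<alpha> ^ k < 1} \<subseteq> E k \<and> measure lebesgue (E k) \<le> s k"
    "summable s"
    and E': "\<And>k. E' k \<in> lmeasurable \<and> {\<theta> \<in> V. \<bar>l \<theta>\<bar> * \<alpha> ^ k < 1} \<subseteq> E' k \<and> measure lebesgue (E' k) \<le> s' k"
    "summable s'"
    using assms unfolding summable_sublevels_def by blast
  show ?thesis
    unfolding summable_sublevels_def
  proof (intro exI conjI allI)
    fix k
    show "E k \<union> E' k \<in> lmeasurable" using E E' by blast
    show "{\<theta> \<in> U \<union> V. \<bar>l \<theta>\<bar> * \<alpha> ^ k < 1} \<subseteq> E k \<union> E' k" using E(1)[of k] E'(1)[of k] by blast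
    show "measure lebesgue (E k \<union> E' k) \<le> s k + s' k"
      using measure_Un_le[of "E k" lebesgue "E' k"] E(1)[of k] E'(1)[of k] by (simp add: fmeasurableD)
  next
    show "summable (\<lambda>k. s k + s' k)" using E(2) E'(2) by (rule summable_add)
  qed
qed

text \<open>Near a zero of order \<open>m\<close> the sublevel condition forces the distance to the
  zero to be at most \<open>(c * \<alpha> ^ k)\<close> to the power \<open>-1/m\<close>, which
  decays geometrically in \<open>k\<close>. Away from the zeros the sublevel sets are locally empty
  for large \<open>k\<close>.\<close>

lemma summable_sublevels_local:
  assumes cont: "continuous_on UNIV l" and fin: "finite_order_zeros l" and "\<alpha> > 1"
  shows "\<exists>W. open W \<and> x \<in> W \<and> summable_sublevels l \<alpha> W"
proof (cases "l x = 0")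
  case True
  then obtain m c r where m: "c > 0" "r > 0" "\<And>\<theta>. \<bar>\<theta> - x\<bar> < r \<Longrightarrow> c * \<bar>\<theta> - x\<bar> ^ m \<le> \<bar>l \<theta>\<bar>"
    using fin unfolding finite_order_zeros_def by blast
  \<comment> \<open>Order \<open>0\<close> would give \<open>c \<le> 0\<close> at the zero
    itself.\<close>
  have "m > 0" using m(3)[of x] m(1,2) True by (cases m) auto
  define \<rho> where "\<rho> k = root m (1 / (c * \<alpha> ^ k))" for k
  have \<rho>: "\<rho> k = root m (1 / c) * (1 / root m \<alpha>) ^ k" for k
    using \<open>m > 0\<close> \<open>\<alpha> > 1\<close> unfolding \<rho>_def
    by (simp add: real_root_mult real_root_divide real_root_power power_divide)
  have \<rho>_pos: "\<rho> k \<ge> 0" for k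
    unfolding \<rho>_def using m(1) \<open>\<alpha> > 1\<close> \<open>m > 0\<close> by (intro real_root_ge_zero) auto
  show ?thesis
  proof (intro exI conjI)
    show "open (ball x r)" "x \<in> ball x r" using m(2) by auto
    show "summable_sublevels l \<alpha> (ball x r)"
      unfolding summable_sublevels_def
    proof (intro exI conjI allI)
      fix k
      show "{x - \<rho> k .. x + \<rho> k} \<in> lmeasurable" by simp
      show "measure lebesgue {x - \<rho> k .. x + \<rho> k} \<le> 2 * (root m (1 / c) * (1 / root m \<alpha>) ^ k)"
        using \<rho>_pos[of k] by (simp flip: \<rho>)
      show "{\<theta> \<in> ball x r. \<bar>l \<theta>\<bar> * \<alpha> ^ k < 1} \<subseteq> {x - \<rho> k .. x + \<rho> k}"
      proof safe
        fix \<theta> assume \<theta>: "\<theta> \<in> ball x r" "\<bar>l \<theta>\<bar> * \<alpha> ^ k < 1"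
        have "c * \<bar>\<theta> - x\<bar> ^ m \<le> \<bar>l \<theta>\<bar>" using m(3)[of \<theta>] \<theta>(1) by (simp add: dist_real_def)
        then have "c * \<bar>\<theta> - x\<bar> ^ m * \<alpha> ^ k \<le> \<bar>l \<theta>\<bar> * \<alpha> ^ k"
          using \<open>\<alpha> > 1\<close> by (intro mult_right_mono) auto
        with \<theta>(2) have "c * \<bar>\<theta> - x\<bar> ^ m * \<alpha> ^ k < 1" by linarith
        then have "\<bar>\<theta> - x\<bar> ^ m \<le> 1 / (c * \<alpha> ^ k)"
          using m(1) \<open>\<alpha> > 1\<close> by (simp add: field_simps)
        then have "root m (\<bar>\<theta> - x\<bar> ^ m) \<le> \<rho> k"
          unfolding \<rho>_def using \<open>m > 0\<close> by (simp add: real_root_le_iff)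
        then have "\<bar>\<theta> - x\<bar> \<le> \<rho> k" using \<open>m > 0\<close> by (simp add: real_root_power_cancel)
        then show "\<theta> \<in> {x - \<rho> k .. x + \<rho> k}" by auto
      qed
    next
      show "summable (\<lambda>k. 2 * (root m (1 / c) * (1 / root m \<alpha>) ^ k))"
        using \<open>m > 0\<close> \<open>\<alpha> > 1\<close> by (intro summable_mult summable_geometric) auto
    qed
  qed
next
  case False
  have "\<exists>W. open W \<and> x \<in> W \<and> (\<forall>y\<in>W. \<bar>l x\<bar> / 2 < \<bar>l y\<bar>)"
    using False by (intro exI[of _ "{y. \<bar>l x\<bar> / 2 < \<bar>l y\<bar>}"] conjI open_Collect_less continuous_intros cont) auto
  then obtain W where W: "open W" "x \<in> W" "\<And>y. y \<in> W \<Longrightarrow> \<bar>l x\<bar> / 2 < \<bar>l y\<bar>" by blast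
  obtain K where K: "2 / \<bar>l x\<bar> < \<alpha> ^ K" using real_arch_pow[OF \<open>\<alpha> > 1\<close>] by blast
  have small: "\<not> \<bar>l y\<bar> * \<alpha> ^ k < 1" if "y \<in> W" "k \<ge> K" for y k
  proof -
    have "2 / \<bar>l x\<bar> \<le> \<alpha> ^ k"
      using K power_increasing[OF that(2), of \<alpha>] \<open>\<alpha> > 1\<close> by linarith
    then have "1 \<le> \<bar>l x\<bar> / 2 * \<alpha> ^ k" using False by (simp add: field_simps)
    also have "\<dots> \<le> \<bar>l y\<bar> * \<alpha> ^ k" using W(3)[OF that(1)] \<open>\<alpha> > 1\<close> by (intro mult_right_mono) auto
    finally show ?thesis by simp
  qed
  \<comment> \<open>The finitely many nonempty sublevel sets are covered by a unit ball, which is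
    why \<open>W\<close> is cut down to it below.\<close>
  define E where "E k = (if k < K then ball x 1 else {})" for k
  show ?thesis
  proof (intro exI conjI)
    show "open (W \<inter> ball x 1)" "x \<in> W \<inter> ball x 1" using W by auto
    show "summable_sublevels l \<alpha> (W \<inter> ball x 1)"
      unfolding summable_sublevels_def
    proof (intro exI conjI allI)
      fix k
      show "E k \<in> lmeasurable" by (simp add: E_def)
      show "{\<theta> \<in> W \<inter> ball x 1. \<bar>l \<theta>\<bar> * \<alpha> ^ k < 1} \<subseteq> E k"
        using small[of _ k] by (auto simp: E_def)
      show "measure lebesgue (E k) \<le> (if k \<in> {..<K} then measure lebesgue (ball x 1) else 0)"
        by (simp add: E_def)
    next
      show "summable (\<lambda>k. if k \<in> {..<K} then measure lebesgue (ball x 1) else 0)"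
        by (rule summable_If_finite_set) simp
    qed
  qed
qed

lemma summable_sublevels_compact:
  assumes "continuous_on UNIV l" "finite_order_zeros l" "\<alpha> > 1" "compact S"
  shows "summable_sublevels l \<alpha> S"
proof (rule compact_local_to_global[OF \<open>compact S\<close>])
  show "summable_sublevels l \<alpha> {}"
    unfolding summable_sublevels_def
    by (intro exI[of _ "\<lambda>_. {}"] exI[of _ "\<lambda>_. 0"]) auto
  show "summable_sublevels l \<alpha> U" if V: "summable_sublevels l \<alpha> V" "U \<subseteq> V" for U V
  proof -
    obtain E s where E: "\<And>k. E k \<in> lmeasurable"
      "\<And>k. {\<theta> \<in> V. \<bar>l \<theta>\<bar> * \<alpha> ^ k < 1} \<subseteq> E k"
      "\<And>k. measure lebesgue (E k) \<le> s k" "summable s"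
      using V(1) unfolding summable_sublevels_def by blast
    have "{\<theta> \<in> U. \<bar>l \<theta>\<bar> * \<alpha> ^ k < 1} \<subseteq> E k" for k
      using V(2) E(2)[of k] by auto
    then show ?thesis
      using E(1,3,4) unfolding summable_sublevels_def by (intro exI[of _ E] exI[of _ s]) simp
  qed
  show "summable_sublevels l \<alpha> (U \<union> V)" if "summable_sublevels l \<alpha> U" "summable_sublevels l \<alpha> V" for U V
    using that by (rule summable_sublevels_Un)
  show "\<exists>U. open U \<and> x \<in> U \<and> summable_sublevels l \<alpha> U" for x
    using assms(1,2,3) by (rule summable_sublevels_local)
qed

text \<open>Borel-Cantelli: almost every point has only finitely many \<open>k\<close> at which the
  backward orbit meets the \<open>k\<close>-th sublevel set. The remaining finitely many values are
  positive unless the orbit hits a zero, which excludes only a further null set.\<close>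

lemma negligible_no_uniform_bound:
  assumes cont: "continuous_on UNIV l" and per: "circle_fun l"
    and fin: "finite_order_zeros l" and "\<alpha> > 1"
  shows "negligible ({0..<2 * pi} \<inter> {\<theta>. \<not> (\<exists>c>0. \<forall>k::nat. c \<le> \<alpha> ^ k * \<bar>l (\<theta> - real k * \<omega>)\<bar>)})"
proof -
  have "summable_sublevels l \<alpha> {- (2 * pi)..2 * pi}"
    using assms by (intro summable_sublevels_compact) auto
  then obtain E s where
    E: "\<And>k. E k \<in> lmeasurable" "\<And>k. {\<theta> \<in> {- (2 * pi)..2 * pi}. \<bar>l \<theta>\<bar> * \<alpha> ^ k < 1} \<subseteq> E k"
      "\<And>k. measure lebesgue (E k) \<le> s k" "summable s"
    unfolding summable_sublevels_def by blast
  \<comment> \<open>Reducing \<open>real k * \<omega>\<close> modulo the period to a shift in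
    \<open>{0..<2 * pi}\<close> lets one compact interval of length \<open>4 * pi\<close> serve
    every \<open>k\<close>.\<close>
  have "\<exists>d::real. \<forall>\<theta>\<in>{0..<2 * pi}. \<theta> - d \<in> {- (2 * pi)..2 * pi} \<and> l (\<theta> - real k * \<omega>) = l (\<theta> - d)" for k
  proof -
    obtain j :: int where j: "real k * \<omega> + of_int j * (2 * pi) \<in> {0..<2 * pi}"
      using circle_fun_reduce .
    have "l (\<theta> - real k * \<omega>) = l (\<theta> - (real k * \<omega> + of_int j * (2 * pi)))" for \<theta>
      using circle_fun_int[OF per, of "\<theta> - real k * \<omega>" "- j"] by (simp add: algebra_simps)
    then show ?thesis using j by (intro exI[of _ "real k * \<omega> + of_int j * (2 * pi)"]) auto
  qed
  then have "\<forall>k. \<exists>d. \<forall>\<theta>\<in>{0..<2 * pi}. \<theta> - d \<in> {- (2 * pi)..2 * pi} \<and> l (\<theta> - real k * \<omega>) = l (\<theta> - d)"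
    by (rule allI)
  from choice[OF this] obtain d :: "nat \<Rightarrow> real" where
    d: "\<And>k \<theta>. \<theta> \<in> {0..<2 * pi} \<Longrightarrow> \<theta> - d k \<in> {- (2 * pi)..2 * pi}"
      "\<And>k \<theta>. \<theta> \<in> {0..<2 * pi} \<Longrightarrow> l (\<theta> - real k * \<omega>) = l (\<theta> - d k)"
    by blast
  \<comment> \<open>Zeros lie in every sublevel set, so \<open>Z\<close> is contained in each
    \<open>E k\<close>, and the measures of these sets tend to zero.\<close>
  define Z where "Z = {\<theta> \<in> {- (2 * pi)..2 * pi}. l \<theta> = 0}"
  have "negligible Z"
    unfolding negligible_outer
  proof (intro allI impI)
    fix e :: real assume "e > 0"
    with summable_LIMSEQ_zero[OF E(4)] have "\<forall>\<^sub>F k in sequentially. s k < e"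
      by (rule order_tendstoD(2))
    then obtain k where "s k < e" unfolding eventually_sequentially by blast
    then show "\<exists>T. Z \<subseteq> T \<and> T \<in> lmeasurable \<and> measure lebesgue T < e"
      using E(1,2,3)[of k] by (intro exI[of _ "E k"]) (auto simp: Z_def intro: le_less_trans)
  qed
  \<comment> \<open>Translation preserves measure, so the sets \<open>B k\<close> still have
    summable measures.\<close>
  define B where "B k = (\<lambda>\<theta>. d k + \<theta>) ` E k" for k
  have B: "B k \<in> lmeasurable" "measure lebesgue (B k) = measure lebesgue (E k)" for k
    unfolding B_def using E(1) measurable_translation measure_translation by (blast, metis)
  have "limsup B \<in> null_sets lebesgue"
  proof (rule borel_cantelli_limsup1)
    show "B k \<in> sets lebesgue" "emeasure lebesgue (B k) < \<infinity>" for k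
      using B(1)[of k] by (auto simp: fmeasurable_def)
    show "summable (\<lambda>k. measure lebesgue (B k))"
      unfolding B(2) by (rule summable_comparison_test'[OF E(4)]) (use E(3) in auto)
  qed
  then have neg: "negligible (limsup B)"
    by (simp add: negligible_iff_null_sets)
  show ?thesis
  proof (rule negligible_subset)
    show "negligible (limsup B \<union> (\<Union>k. (\<lambda>\<theta>. d k + \<theta>) ` Z))"
      using neg \<open>negligible Z\<close> by (intro negligible_Un negligible_countable_Union) (auto intro: negligible_translation)
    show "{0..<2 * pi} \<inter> {\<theta>. \<not> (\<exists>c>0. \<forall>k::nat. c \<le> \<alpha> ^ k * \<bar>l (\<theta> - real k * \<omega>)\<bar>)}
      \<subseteq> limsup B \<union> (\<Union>k. (\<lambda>\<theta>. d k + \<theta>) ` Z)"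
    proof (rule subsetI, rule ccontr)
      fix \<theta> assume \<theta>: "\<theta> \<in> {0..<2 * pi} \<inter> {\<theta>. \<not> (\<exists>c>0. \<forall>k::nat. c \<le> \<alpha> ^ k * \<bar>l (\<theta> - real k * \<omega>)\<bar>)}"
      assume nin: "\<theta> \<notin> limsup B \<union> (\<Union>k. (\<lambda>\<theta>. d k + \<theta>) ` Z)"
      then obtain K where K: "\<And>k. k \<ge> K \<Longrightarrow> \<theta> \<notin> B k" unfolding limsup_INF_SUP by auto
      have nz: "l (\<theta> - real k * \<omega>) \<noteq> 0" for k
      proof
        assume "l (\<theta> - real k * \<omega>) = 0"
        then have "\<theta> - d k \<in> Z" using d[of \<theta> k] \<theta> by (auto simp: Z_def)
        then have "\<theta> \<in> (\<lambda>\<theta>. d k + \<theta>) ` Z" by (intro image_eqI[of _ _ "\<theta> - d k"]) auto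
        then show False using nin by blast
      qed
      have big: "1 \<le> \<alpha> ^ k * \<bar>l (\<theta> - real k * \<omega>)\<bar>" if "k \<ge> K" for k
      proof (rule ccontr)
        assume "\<not> 1 \<le> \<alpha> ^ k * \<bar>l (\<theta> - real k * \<omega>)\<bar>"
        then have "\<theta> - d k \<in> E k" using d[of \<theta> k] \<theta> E(2)[of k] by (auto simp: mult.commute)
        then have "\<theta> \<in> B k" unfolding B_def by (intro image_eqI[of _ _ "\<theta> - d k"]) auto
        then show False using K that by blast
      qed
      \<comment> \<open>The value \<open>1\<close> accounts for all \<open>k \<ge> K\<close>, the
        others for the finitely many earlier times.\<close>
      define c where "c = Min (insert 1 ((\<lambda>k. \<alpha> ^ k * \<bar>l (\<theta> - real k * \<omega>)\<bar>) ` {..<K}))"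
      have "c > 0" unfolding c_def using nz \<open>\<alpha> > 1\<close> by (subst Min_gr_iff) auto
      moreover have "c \<le> \<alpha> ^ k * \<bar>l (\<theta> - real k * \<omega>)\<bar>" for k
      proof (cases "k < K")
        case True
        then show ?thesis unfolding c_def by (intro Min_le) auto
      next
        case False
        have "c \<le> 1" unfolding c_def by (intro Min_le) auto
        then show ?thesis using big[of k] False by simp
      qed
      ultimately show False using \<theta> by blast
    qed
  qed
qed

section \<open>Holomorphic extensions of real functions\<close>

text \<open>Extensions are kept on discs about single real points, so that no gluing into a function
  on a strip is required.\<close>

definition holo_ext :: "(real \<Rightarrow> real) \<Rightarrow> real \<Rightarrow> real \<Rightarrow> (complex \<Rightarrow> complex) \<Rightarrow> bool" where
  "holo_ext f p r G \<longleftrightarrow> 0 < r \<and> G holomorphic_on ball (of_real p) r \<and>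
     (\<forall>x. \<bar>x - p\<bar> < r \<longrightarrow> G (of_real x) = of_real (f x))"

lemma holo_ext_subset:
  assumes "holo_ext f p r G" "0 < s" "\<bar>q - p\<bar> + s \<le> r"
  shows "holo_ext f q s G"
proof -
  have "ball (complex_of_real q) s \<subseteq> ball (of_real p) r"
    using assms by (subst ball_subset_ball_iff) (simp add: dist_of_real dist_real_def)
  then show ?thesis
    using assms unfolding holo_ext_def by (auto intro: holomorphic_on_subset)
qed

text \<open>The real power series is summed at complex arguments. Its convergence at a real radius
  \<open>t\<close> strictly beyond \<open>norm (z - of_real p)\<close> yields convergence at
  \<open>z\<close>.\<close>

lemma real_analytic_holo_ext:
  assumes "real_analytic f"
  shows "\<exists>r G. holo_ext f p r G"
proof -
  obtain r c where r: "r > 0" and c: "\<And>x. \<bar>x - p\<bar> < r \<Longrightarrow> (\<lambda>n. c n * (x - p) ^ n) sums f x"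
    using assms unfolding real_analytic_def by blast
  define G where "G z = (\<Sum>n. of_real (c n) * (z - of_real p) ^ n)" for z :: complex
  have "summable (\<lambda>n. of_real (c n) * (z - of_real p) ^ n)" if z: "z \<in> ball (of_real p) r" for z :: complex
  proof -
    have "norm (z - of_real p) < r" using z by (simp add: dist_norm norm_minus_commute)
    then obtain t where t: "norm (z - of_real p) < t" "t < r" using dense by blast
    have "0 < t" using norm_ge_zero t(1) by (rule le_less_trans)
    then have "summable (\<lambda>n. c n * t ^ n)"
      using c[of "p + t"] t(2) by (simp add: sums_iff)
    then have "summable (\<lambda>n. of_real (c n * t ^ n) :: complex)"
      by (rule summable_of_real)
    then have "summable (\<lambda>n. of_real (c n) * of_real t ^ n :: complex)" by simp
    then show ?thesis
      by (rule powser_inside) (use t(1) \<open>0 < t\<close> in simp)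
  qed
  then have "G holomorphic_on ball (of_real p) r"
    unfolding G_def by (intro power_series_holomorphic[where a = "\<lambda>n. of_real (c n)"] summable_sums)
  moreover have "G (of_real x) = of_real (f x)" if "\<bar>x - p\<bar> < r" for x
  proof -
    have "(\<lambda>n. of_real (c n * (x - p) ^ n)) sums (of_real (f x) :: complex)"
      using c[OF that] by (rule sums_of_real)
    then show ?thesis unfolding G_def by (simp add: sums_iff)
  qed
  ultimately show ?thesis using r unfolding holo_ext_def by blast
qed

text \<open>Compactness of a period makes the radius and the bound independent of the centre. This
  uniformity is what permits summing infinitely many translates on one disc.\<close>

lemma real_analytic_circle_bounded_ext:
  assumes an: "real_analytic f" and per: "circle_fun f"
  shows "\<exists>r M. \<forall>p. \<exists>G. holo_ext f p r G \<and> (\<forall>z\<in>ball (of_real p) r. norm (G z) \<le> M)"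
proof -
  define P where "P W = (\<exists>r>0. \<exists>M. \<forall>p\<in>W. \<exists>G. holo_ext f p r G \<and> (\<forall>z\<in>ball (of_real p) r. norm (G z) \<le> M))"
    for W :: "real set"
  have "P {0..2 * pi}"
  proof (rule compact_local_to_global)
    show "P {}" unfolding P_def by (auto intro: exI[of _ 1])
    show "P U" if "P V" "U \<subseteq> V" for U V using that unfolding P_def by blast
    show "P (U \<union> V)" if UV: "P U" "P V" for U V
    proof -
      obtain r M where U: "r > 0" "\<And>p. p \<in> U \<Longrightarrow> \<exists>G. holo_ext f p r G \<and> (\<forall>z\<in>ball (of_real p) r. norm (G z) \<le> M)"
        using UV(1) unfolding P_def by blast
      obtain r' M' where V: "r' > 0" "\<And>p. p \<in> V \<Longrightarrow> \<exists>G. holo_ext f p r' G \<and> (\<forall>z\<in>ball (of_real p) r'. norm (G z) \<le> M')"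
        using UV(2) unfolding P_def by blast
      have "\<exists>G. holo_ext f p (min r r') G \<and> (\<forall>z\<in>ball (of_real p) (min r r'). norm (G z) \<le> max M M')"
        if p: "p \<in> U \<union> V" for p
        using p
      proof
        assume "p \<in> U"
        then obtain G where "holo_ext f p r G" "\<forall>z\<in>ball (of_real p) r. norm (G z) \<le> M" using U by blast
        then show ?thesis using U(1) V(1) by (intro exI[of _ G]) (auto intro: holo_ext_subset simp: le_max_iff_disj)
      next
        assume "p \<in> V"
        then obtain G where "holo_ext f p r' G" "\<forall>z\<in>ball (of_real p) r'. norm (G z) \<le> M'" using V by blast
        then show ?thesis using U(1) V(1) by (intro exI[of _ G]) (auto intro: holo_ext_subset simp: le_max_iff_disj)
      qed
      moreover have "0 < min r r'" using U(1) V(1) by simp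
      ultimately show ?thesis unfolding P_def by blast
    qed
    show "\<exists>U. open U \<and> x \<in> U \<and> P U" for x
    proof -
      obtain r G where G: "holo_ext f x r G" using real_analytic_holo_ext[OF an] by blast
      then have r: "r > 0" and hol: "G holomorphic_on ball (of_real x) r" unfolding holo_ext_def by auto
      have "compact (G ` cball (of_real x) (r / 2))"
        using r by (intro compact_continuous_image continuous_on_subset[OF holomorphic_on_imp_continuous_on[OF hol]]) auto
      then obtain M where M: "\<And>z. z \<in> cball (of_real x) (r / 2) \<Longrightarrow> norm (G z) \<le> M"
        using compact_imp_bounded bounded_iff by (metis imageI)
      \<comment> \<open>A disc of radius \<open>r / 4\<close> about a point within
        \<open>r / 4\<close> of \<open>x\<close> stays in the closed disc of radius
        \<open>r / 2\<close>, where \<open>G\<close> is bounded by compactness.\<close>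
      have "holo_ext f p (r / 4) G \<and> (\<forall>z\<in>ball (of_real p) (r / 4). norm (G z) \<le> M)" if "p \<in> ball x (r / 4)" for p
      proof
        have px: "\<bar>p - x\<bar> < r / 4" using that by (simp add: dist_real_def abs_minus_commute)
        then show "holo_ext f p (r / 4) G" using holo_ext_subset[OF G, of "r / 4" p] r by simp
        have "ball (complex_of_real p) (r / 4) \<subseteq> cball (of_real x) (r / 2)"
          using px by (subst ball_subset_cball_iff) (simp add: dist_of_real dist_real_def)
        then show "\<forall>z\<in>ball (of_real p) (r / 4). norm (G z) \<le> M" using M by blast
      qed
      moreover have "0 < r / 4" using r by simp
      ultimately have "P (ball x (r / 4))" unfolding P_def by blast
      then show ?thesis using r by (intro exI[of _ "ball x (r / 4)"]) simp
    qed
  qed simp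
  then obtain r M where rM: "r > 0"
    "\<And>p. p \<in> {0..2 * pi} \<Longrightarrow> \<exists>G. holo_ext f p r G \<and> (\<forall>z\<in>ball (of_real p) r. norm (G z) \<le> M)"
    unfolding P_def by blast
  have "\<exists>G. holo_ext f p r G \<and> (\<forall>z\<in>ball (of_real p) r. norm (G z) \<le> M)" for p
  proof -
    obtain j :: int where j: "p + of_int j * (2 * pi) \<in> {0..<2 * pi}" using circle_fun_reduce .
    \<comment> \<open>Translation by this multiple of the period brings the centre into
      \<open>{0..<2 * pi}\<close>; periodicity of \<open>f\<close> lets the extension found there be
      transported back.\<close>
    define s where "s = of_int j * (2 * pi)"
    obtain G where G: "holo_ext f (p + s) r G" "\<And>z. z \<in> ball (of_real (p + s)) r \<Longrightarrow> norm (G z) \<le> M"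
      using rM(2)[of "p + s"] j unfolding s_def by auto
    have shift: "z + of_real s \<in> ball (of_real (p + s)) r" if "z \<in> ball (of_real p) r" for z :: complex
      using that by (simp add: dist_norm)
    have "(G \<circ> (\<lambda>z. z + of_real s)) holomorphic_on ball (of_real p) r"
      using G(1) shift unfolding holo_ext_def
      by (intro holomorphic_on_compose_gen[where t = "ball (of_real (p + s)) r"] holomorphic_intros) auto
    moreover have "G (of_real x + of_real s) = of_real (f x)" if "\<bar>x - p\<bar> < r" for x
      using G(1) that circle_fun_int[OF per, of x j] unfolding holo_ext_def s_def
      by (metis add_diff_cancel_right of_real_add)
    ultimately have "holo_ext f p r (\<lambda>z. G (z + of_real s))"
      using rM(1) unfolding holo_ext_def by (simp add: o_def)
    then show ?thesis using G(2) shift by blast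
  qed
  then show ?thesis by blast
qed

text \<open>Real shifts move the discs along the real axis without shrinking them, so all terms are
  holomorphic on one disc with bounds \<open>\<bar>w k\<bar> * M\<close>. The Weierstrass test then
  makes the sum holomorphic.\<close>

lemma holo_ext_series_of_shifts:
  assumes an: "real_analytic g" and per: "circle_fun g" and w: "summable (\<lambda>k. \<bar>w k\<bar>)"
  shows "\<exists>r G. holo_ext (\<lambda>x. \<Sum>k. w k * g (x + s k)) p r G"
proof -
  obtain r M where "\<forall>p. \<exists>G. holo_ext g p r G \<and> (\<forall>z\<in>ball (of_real p) r. norm (G z) \<le> M)"
    using real_analytic_circle_bounded_ext[OF an per] by blast
  then obtain H where H: "\<And>p. holo_ext g p r (H p)" "\<And>p z. z \<in> ball (of_real p) r \<Longrightarrow> norm (H p z) \<le> M"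
    by metis
  define S where "S = ball (complex_of_real p) r"
  define F where "F k z = of_real (w k) * H (p + s k) (z + of_real (s k))" for k and z :: complex
  have shift: "z + of_real (s k) \<in> ball (of_real (p + s k)) r" if "z \<in> S" for z k
    using that by (simp add: S_def dist_norm)
  have "r > 0" using H(1) unfolding holo_ext_def by blast
  have hol: "F k holomorphic_on S" for k
  proof -
    have "(H (p + s k) \<circ> (\<lambda>z. z + of_real (s k))) holomorphic_on S"
      using H(1)[of "p + s k"] shift unfolding holo_ext_def
      by (intro holomorphic_on_compose_gen[where t = "ball (of_real (p + s k)) r"] holomorphic_intros) auto
    then show ?thesis unfolding F_def by (intro holomorphic_intros) (simp add: o_def)
  qed
  have bound: "norm (F k z) \<le> \<bar>w k\<bar> * M" if "z \<in> S" for k z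
    unfolding F_def norm_mult using H(2)[OF shift[OF that]] by (simp add: mult_left_mono)
  have unif: "uniform_limit S (\<lambda>n z. \<Sum>k<n. F k z) (\<lambda>z. \<Sum>k. F k z) sequentially"
    by (rule Weierstrass_m_test[OF bound summable_mult2[OF w]])
  have "(\<lambda>z. \<Sum>k. F k z) holomorphic_on S"
  proof (rule holomorphic_uniform_sequence)
    show "open S" by (simp add: S_def)
    show "(\<lambda>z. \<Sum>k<n. F k z) holomorphic_on S" for n by (intro holomorphic_intros hol)
    fix z assume "z \<in> S"
    then obtain d where "d > 0" "cball z d \<subseteq> S"
      using open_contains_cball[of S] open_ball unfolding S_def by blast
    then show "\<exists>d>0. cball z d \<subseteq> S \<and> uniform_limit (cball z d) (\<lambda>n z. \<Sum>k<n. F k z) (\<lambda>z. \<Sum>k. F k z) sequentially"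
      using uniform_limit_on_subset[OF unif] by blast
  qed
  moreover have "(\<Sum>k. F k (of_real x)) = of_real (\<Sum>k. w k * g (x + s k))" if x: "\<bar>x - p\<bar> < r" for x
  proof -
    have eq: "F k (of_real x) = of_real (w k * g (x + s k))" for k
    proof -
      have "\<bar>(x + s k) - (p + s k)\<bar> < r" using x by simp
      then have "H (p + s k) (of_real (x + s k)) = of_real (g (x + s k))"
        using H(1)[of "p + s k"] unfolding holo_ext_def by blast
      then show ?thesis unfolding F_def by simp
    qed
    have "summable (\<lambda>k. norm (F k (of_real x)))"
      using x by (intro summable_comparison_test'[OF summable_mult2[OF w, of M]])
        (auto intro!: bound simp: S_def dist_of_real dist_real_def abs_minus_commute)
    then have "summable (\<lambda>k. w k * g (x + s k))"
      unfolding eq norm_of_real by (rule summable_rabs_cancel)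
    then show ?thesis unfolding eq by (rule suminf_of_real[symmetric])
  qed
  ultimately show ?thesis
    using \<open>r > 0\<close> unfolding holo_ext_def S_def by blast
qed

lemma holo_ext_affine:
  assumes "holo_ext f (p - s) r G"
  shows "holo_ext (\<lambda>x. A + B * f (x - s)) p r (\<lambda>z. of_real A + of_real B * G (z - of_real s))"
proof -
  have "(G \<circ> (\<lambda>z. z - of_real s)) holomorphic_on ball (of_real p) r"
    using assms unfolding holo_ext_def
    by (intro holomorphic_on_compose_gen[where t = "ball (of_real (p - s)) r"] holomorphic_intros)
      (auto simp: dist_norm algebra_simps)
  moreover have "G (of_real x - of_real s) = of_real (f (x - s))" if "\<bar>x - p\<bar> < r" for x
    using assms that unfolding holo_ext_def by (metis diff_diff_eq2 diff_add_cancel of_real_diff diff_diff_add add.commute)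
  ultimately show ?thesis
    using assms unfolding holo_ext_def by (auto intro!: holomorphic_intros simp: o_def)
qed

text \<open>Identity theorem: real zeros of \<open>f\<close> accumulating at \<open>p\<close> are
  zeros of \<open>G\<close> accumulating at the centre of its disc.\<close>

lemma holo_ext_imp_zeros_isolated:
  assumes "holo_ext f p r G"
  shows "(\<forall>x. \<bar>x - p\<bar> < r \<longrightarrow> f x = 0) \<or> (\<exists>d>0. \<forall>x. 0 < \<bar>x - p\<bar> \<and> \<bar>x - p\<bar> < d \<longrightarrow> f x \<noteq> 0)"
proof (rule ccontr)
  assume contr: "\<not> ?thesis"
  have hol: "G holomorphic_on ball (of_real p) r" "r > 0"
    and eq: "\<And>x. \<bar>x - p\<bar> < r \<Longrightarrow> G (of_real x) = of_real (f x)"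
    using assms unfolding holo_ext_def by auto
  define U where "U = complex_of_real ` {x. \<bar>x - p\<bar> < r \<and> f x = 0}"
  have in_ball: "complex_of_real x \<in> ball (of_real p) r \<longleftrightarrow> \<bar>x - p\<bar> < r" for x
    by (simp add: dist_of_real dist_real_def abs_minus_commute)
  have "complex_of_real p islimpt U"
    unfolding islimpt_approachable
  proof (intro allI impI)
    fix e :: real assume "e > 0"
    then have "min e r > 0" using hol by simp
    then obtain x where "0 < \<bar>x - p\<bar>" "\<bar>x - p\<bar> < min e r" "f x = 0"
      using contr by blast
    then show "\<exists>x'\<in>U. x' \<noteq> of_real p \<and> dist x' (of_real p) < e"
      unfolding U_def by (intro bexI[of _ "of_real x"]) (auto simp: dist_of_real dist_real_def)
  qed
  then have "G w = 0" if "w \<in> ball (of_real p) r" for w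
    using that hol eq in_ball
    by (intro analytic_continuation[OF hol(1), of U "of_real p" w]) (auto simp: U_def)
  then have "f x = 0" if "\<bar>x - p\<bar> < r" for x
    using eq[OF that] in_ball[of x] that by simp
  then show False using contr by blast
qed

text \<open>If \<open>f\<close> vanished near one point, it would vanish everywhere by connectedness
  of the line. So at each zero the extension is nonconstant and factors as a power times a
  nonvanishing holomorphic function, whose modulus is locally bounded below.\<close>

lemma finite_order_zerosI_holo_ext:
  assumes ext: "\<And>p. \<exists>r G. holo_ext f p r G" and nz: "f x0 \<noteq> 0"
  shows "finite_order_zeros f"
proof -
  \<comment> \<open>The points near which \<open>f\<close> vanishes identically; isolation of zeros
    makes this set closed as well as open, and \<open>x0\<close> makes it empty.\<close>
  define S where "S = {p. \<exists>d>0. \<forall>x. \<bar>x - p\<bar> < d \<longrightarrow> f x = 0}"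
  have "open S"
    unfolding open_dist
  proof safe
    fix p assume "p \<in> S"
    then obtain d where d: "d > 0" "\<And>x. \<bar>x - p\<bar> < d \<Longrightarrow> f x = 0" unfolding S_def by blast
    have "y \<in> S" if y: "dist y p < d / 2" for y
    proof -
      have "f x = 0" if "\<bar>x - y\<bar> < d / 2" for x
        using y that unfolding dist_real_def by (intro d(2)) linarith
      then show ?thesis unfolding S_def using d(1) by (intro CollectI exI[of _ "d / 2"]) auto
    qed
    then show "\<exists>e>0. \<forall>y. dist y p < e \<longrightarrow> y \<in> S" using d(1) by (intro exI[of _ "d / 2"]) auto
  qed
  moreover have "open (- S)"
    unfolding open_dist
  proof safe
    fix p assume "p \<notin> S"
    obtain r G where "holo_ext f p r G" using ext by blast
    then have "r > 0" and "(\<forall>x. \<bar>x - p\<bar> < r \<longrightarrow> f x = 0) \<or>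
        (\<exists>d>0. \<forall>x. 0 < \<bar>x - p\<bar> \<and> \<bar>x - p\<bar> < d \<longrightarrow> f x \<noteq> 0)"
      using holo_ext_imp_zeros_isolated unfolding holo_ext_def by blast+
    then obtain d where d: "d > 0" "\<And>x. 0 < \<bar>x - p\<bar> \<Longrightarrow> \<bar>x - p\<bar> < d \<Longrightarrow> f x \<noteq> 0"
      using \<open>p \<notin> S\<close> unfolding S_def by blast
    have "y \<notin> S" if y: "dist y p < d" for y
    proof (cases "y = p")
      case False
      then have "f y \<noteq> 0" using d(2)[of y] y by (simp add: dist_real_def)
      then show ?thesis unfolding S_def by (auto intro!: exI[of _ y])
    qed (use \<open>p \<notin> S\<close> in simp)
    then show "\<exists>e>0. \<forall>y. dist y p < e \<longrightarrow> y \<in> - S" using d(1) by auto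
  qed
  moreover have "x0 \<notin> S" using nz unfolding S_def by (auto intro!: exI[of _ x0])
  ultimately have "S = {}"
    using connectedD[OF connected_UNIV, of S "- S"] by auto
  show ?thesis
    unfolding finite_order_zeros_def
  proof (intro allI impI)
    fix \<zeta> assume \<zeta>: "f \<zeta> = 0"
    obtain r G where ext: "holo_ext f \<zeta> r G" using assms(1) by blast
    then have r: "r > 0" and hol: "G holomorphic_on ball (of_real \<zeta>) r"
      and eq: "\<And>x. \<bar>x - \<zeta>\<bar> < r \<Longrightarrow> G (of_real x) = of_real (f x)"
      unfolding holo_ext_def by auto
    have G0: "G (of_real \<zeta>) = 0" using eq[of \<zeta>] r \<zeta> by simp
    have nonconst: "\<not> G constant_on ball (of_real \<zeta>) r"
    proof
      assume "G constant_on ball (of_real \<zeta>) r"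
      then have "G z = 0" if "z \<in> ball (of_real \<zeta>) r" for z
        using G0 r that unfolding constant_on_def by (metis centre_in_ball)
      then have "\<zeta> \<in> S"
        unfolding S_def using eq r
        by (intro CollectI exI[of _ r]) (auto simp: dist_of_real dist_real_def abs_minus_commute)
      then show False using \<open>S = {}\<close> by blast
    qed
    obtain H t n where H: "0 < t"
      "H holomorphic_on ball (of_real \<zeta>) t"
      "\<And>z. z \<in> ball (of_real \<zeta>) t \<Longrightarrow> G z = (z - of_real \<zeta>) ^ n * H z"
      "\<And>z. z \<in> ball (of_real \<zeta>) t \<Longrightarrow> H z \<noteq> 0"
      by (rule holomorphic_factor_zero_nonconstant[OF hol open_ball connected_ball
            centre_in_ball[THEN iffD2, OF r] G0 nonconst]) (rule that; assumption)
    have "isCont H (of_real \<zeta>)"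
      using holomorphic_on_imp_continuous_on[OF H(2)] H(1) by (simp add: continuous_on_eq_continuous_at)
    moreover have H0: "norm (H (of_real \<zeta>)) > 0" using H(1,4) by simp
    ultimately obtain d where d: "d > 0"
      "\<And>z. dist z (of_real \<zeta>) < d \<Longrightarrow> dist (H z) (H (of_real \<zeta>)) < norm (H (of_real \<zeta>)) / 2"
      unfolding continuous_at_eps_delta by (meson half_gt_zero)
    show "\<exists>m c r. 0 < c \<and> 0 < r \<and> (\<forall>\<theta>. \<bar>\<theta> - \<zeta>\<bar> < r \<longrightarrow> c * \<bar>\<theta> - \<zeta>\<bar> ^ m \<le> \<bar>f \<theta>\<bar>)"
    proof (intro exI conjI allI impI)
      show "0 < norm (H (of_real \<zeta>)) / 2" "0 < min (min d t) r" using H0 d H r by auto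
      fix x assume x: "\<bar>x - \<zeta>\<bar> < min (min d t) r"
      then have "dist (H (of_real x)) (H (of_real \<zeta>)) < norm (H (of_real \<zeta>)) / 2"
        by (intro d(2)) (simp add: dist_of_real dist_real_def)
      then have "norm (H (of_real \<zeta>)) / 2 \<le> norm (H (of_real x))"
        unfolding dist_norm using norm_triangle_ineq2[of "H (of_real \<zeta>)" "H (of_real x)"]
        by (simp add: norm_minus_commute)
      moreover have "of_real (f x) = (of_real x - of_real \<zeta>) ^ n * H (of_real x)"
        using x eq[of x] H(3)[of "of_real x"] by (simp add: dist_of_real dist_real_def abs_minus_commute)
      then have "\<bar>f x\<bar> = \<bar>x - \<zeta>\<bar> ^ n * norm (H (of_real x))"
        by (metis norm_mult norm_of_real norm_power of_real_diff)
      ultimately show "norm (H (of_real \<zeta>)) / 2 * \<bar>x - \<zeta>\<bar> ^ n \<le> \<bar>f x\<bar>"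
        by (simp only: mult.commute[of "_ / 2"] mult_left_mono zero_le_power abs_ge_zero)
    qed
  qed
qed

section \<open>The cohomological equation\<close>

lemma circle_fun_bounded:
  assumes "circle_fun f" "continuous_on UNIV f"
  obtains M where "\<And>x. \<bar>f x\<bar> \<le> M"
proof -
  have "compact (f ` {0..2 * pi})"
    by (intro compact_continuous_image continuous_on_subset[OF assms(2)]) auto
  then obtain M where M: "\<And>x. x \<in> {0..2 * pi} \<Longrightarrow> \<bar>f x\<bar> \<le> M"
    using compact_imp_bounded bounded_iff by (metis imageI real_norm_def)
  have "\<bar>f x\<bar> \<le> M" for x
  proof -
    obtain j :: int where "x + of_int j * (2 * pi) \<in> {0..<2 * pi}" using circle_fun_reduce .
    then show ?thesis using M[of "x + of_int j * (2 * pi)"] circle_fun_int[OF assms(1), of x j] by simp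
  qed
  then show thesis by (rule that)
qed

text \<open>The continuous solution \<open>N\<close> of
  \<open>N (\<theta> + \<omega>) = a * N \<theta> + g \<theta>\<close>: solve for
  \<open>N \<theta>\<close> and iterate forward, which converges as
  \<open>\<bar>a\<bar> > 1\<close>.\<close>

definition twisted_sum :: "real \<Rightarrow> real \<Rightarrow> (real \<Rightarrow> real) \<Rightarrow> real \<Rightarrow> real" where
  "twisted_sum a \<omega> g \<theta> = (\<Sum>k. - ((1 / a) ^ Suc k) * g (\<theta> + real k * \<omega>))"

lemma twisted_sum_summable_weights:
  assumes "\<bar>a\<bar> > (1::real)"
  shows "summable (\<lambda>k. \<bar>- ((1 / a) ^ Suc k)\<bar>)"
proof -
  have "summable (\<lambda>k. \<bar>1 / a\<bar> ^ Suc k)"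
    using assms by (subst summable_Suc_iff) (auto intro!: summable_geometric)
  then show ?thesis by (simp only: abs_minus_cancel power_abs)
qed

context
  fixes a \<omega> :: real and g :: "real \<Rightarrow> real"
  assumes a: "\<bar>a\<bar> > 1" and per: "circle_fun g" and cont: "continuous_on UNIV g"
begin

lemma twisted_sum_uniform_limit:
  "uniform_limit UNIV (\<lambda>n \<theta>. \<Sum>k<n. - ((1 / a) ^ Suc k) * g (\<theta> + real k * \<omega>)) (twisted_sum a \<omega> g) sequentially"
proof -
  obtain M where M: "\<And>x. \<bar>g x\<bar> \<le> M" using circle_fun_bounded[OF per cont] by blast
  show ?thesis
    unfolding twisted_sum_def
  proof (rule Weierstrass_m_test)
    show "norm (- ((1 / a) ^ Suc k) * g (\<theta> + real k * \<omega>)) \<le> \<bar>- ((1 / a) ^ Suc k)\<bar> * M" for k \<theta>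
      unfolding real_norm_def abs_mult by (intro mult_left_mono M) simp
    show "summable (\<lambda>k. \<bar>- ((1 / a) ^ Suc k)\<bar> * M)"
      by (intro summable_mult2 twisted_sum_summable_weights a)
  qed
qed

lemma twisted_sum_continuous: "continuous_on UNIV (twisted_sum a \<omega> g)"
  by (rule uniform_limit_theorem[OF _ twisted_sum_uniform_limit])
    (use a in \<open>auto intro!: always_eventually continuous_intros continuous_on_compose2[OF cont]\<close>)

lemma twisted_sum_circle: "circle_fun (twisted_sum a \<omega> g)"
proof (rule periodic_fun_simple.intro)
  fix x
  have "g (x + 2 * pi + real k * \<omega>) = g (x + real k * \<omega>)" for k
    using periodic_fun_simple.plus_period[OF per, of "x + real k * \<omega>"] by (simp add: add_ac)
  then show "twisted_sum a \<omega> g (x + 2 * pi) = twisted_sum a \<omega> g x"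
    by (simp add: twisted_sum_def)
qed

lemma twisted_sum_shift: "twisted_sum a \<omega> g (\<theta> + \<omega>) = a * twisted_sum a \<omega> g \<theta> + g \<theta>"
proof -
  have "(\<lambda>n. \<Sum>k<n. - ((1 / a) ^ Suc k) * g (\<theta> + real k * \<omega>)) \<longlonglongrightarrow> twisted_sum a \<omega> g \<theta>" for \<theta>
    using tendsto_uniform_limitI[OF twisted_sum_uniform_limit] by simp
  then have sums: "(\<lambda>k. - ((1 / a) ^ Suc k) * g (\<theta> + real k * \<omega>)) sums twisted_sum a \<omega> g \<theta>" for \<theta>
    by (simp add: sums_def)
  \<comment> \<open>The split-off term at \<open>k = 0\<close> equals
    \<open>- g \<theta> / a\<close>. Multiplying the rest by \<open>a\<close> gives the series at
    \<open>\<theta> + \<omega>\<close>.\<close>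
  have tail: "(\<lambda>k. - ((1 / a) ^ Suc (Suc k)) * g (\<theta> + real (Suc k) * \<omega>)) sums (twisted_sum a \<omega> g \<theta> + g \<theta> / a)"
    using sums[of \<theta>] by (subst sums_Suc_iff) simp
  have term_eq: "a * (- ((1 / a) ^ Suc (Suc k)) * g (\<theta> + real (Suc k) * \<omega>)) =
      - ((1 / a) ^ Suc k) * g (\<theta> + \<omega> + real k * \<omega>)" for k
  proof -
    have arg: "\<theta> + real (Suc k) * \<omega> = \<theta> + \<omega> + real k * \<omega>" by (simp add: algebra_simps)
    show ?thesis unfolding arg using a by auto
  qed
  have "a * (twisted_sum a \<omega> g \<theta> + g \<theta> / a) = a * twisted_sum a \<omega> g \<theta> + g \<theta>"
    using a by (auto simp: algebra_simps)
  with sums_mult[OF tail, of a]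
  have "(\<lambda>k. - ((1 / a) ^ Suc k) * g (\<theta> + \<omega> + real k * \<omega>)) sums (a * twisted_sum a \<omega> g \<theta> + g \<theta>)"
    unfolding term_eq by simp
  then show ?thesis using sums[of "\<theta> + \<omega>"] sums_unique2 by blast
qed

text \<open>The constant \<open>e / (1 - a)\<close> is the fixed point of
  \<open>x \<mapsto> a * x + e\<close>. For uniqueness, the difference of two solutions is bounded
  on the circle but multiplied by \<open>a\<close> at every rotation, so it vanishes.\<close>

lemma cont_solution_affine:
  "cont_solution \<omega> (\<lambda>\<theta> x. a * x + e + c * g \<theta>) = (\<lambda>\<theta>. e / (1 - a) + c * twisted_sum a \<omega> g \<theta>)"
  unfolding cont_solution_def
proof (rule the_equality)
  let ?u = "\<lambda>\<theta>. e / (1 - a) + c * twisted_sum a \<omega> g \<theta>"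
  have "a \<noteq> 1" using a by auto
  have shift: "?u (\<theta> + \<omega>) = a * ?u \<theta> + e + c * g \<theta>" for \<theta>
    unfolding twisted_sum_shift using \<open>a \<noteq> 1\<close> by (simp add: field_simps)
  have u: "circle_fun ?u" "continuous_on UNIV ?u"
    using periodic_fun_simple.plus_period[OF twisted_sum_circle] twisted_sum_continuous
    by (auto intro!: periodic_fun_simple.intro continuous_intros)
  with shift show "circle_fun ?u \<and> continuous_on UNIV ?u \<and> (\<forall>\<theta>. ?u (\<theta> + \<omega>) = a * ?u \<theta> + e + c * g \<theta>)"
    by blast
  fix v assume v: "circle_fun v \<and> continuous_on UNIV v \<and> (\<forall>\<theta>. v (\<theta> + \<omega>) = a * v \<theta> + e + c * g \<theta>)"
  define d where "d \<theta> = v \<theta> - ?u \<theta>" for \<theta>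
  have "circle_fun d" "continuous_on UNIV d"
    unfolding d_def using u v periodic_fun_simple.plus_period[of v "2 * pi"] periodic_fun_simple.plus_period[OF u(1)]
    by (auto intro!: periodic_fun_simple.intro continuous_on_diff)
  then obtain M where M: "\<And>x. \<bar>d x\<bar> \<le> M" using circle_fun_bounded by blast
  have step: "d (\<theta> + \<omega>) = a * d \<theta>" for \<theta>
  proof -
    have "v (\<theta> + \<omega>) = a * v \<theta> + e + c * g \<theta>" using v by blast
    then show ?thesis unfolding d_def shift by (simp add: right_diff_distrib)
  qed
  have iter: "d (\<theta> + real n * \<omega>) = a ^ n * d \<theta>" for n \<theta>
  proof (induction n)
    case (Suc n)
    then show ?case using step[of "\<theta> + real n * \<omega>"] by (simp add: algebra_simps)
  qed simp
  have "d \<theta> = 0" for \<theta>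
  proof (rule ccontr)
    assume "d \<theta> \<noteq> 0"
    obtain n where "M / \<bar>d \<theta>\<bar> < \<bar>a\<bar> ^ n" using real_arch_pow[OF a] by blast
    then have "M < \<bar>d (\<theta> + real n * \<omega>)\<bar>"
      unfolding iter abs_mult power_abs using \<open>d \<theta> \<noteq> 0\<close> by (simp add: field_simps)
    then show False using M[of "\<theta> + real n * \<omega>"] by simp
  qed
  then show "v = ?u" unfolding d_def by auto
qed

end

section \<open>The maps at the bifurcation value\<close>

lemma circle_fun_translate: "circle_fun f \<Longrightarrow> f (x + 2 * pi - c) = f (x - c)"
  using periodic_fun_simple.plus_period[of f "2 * pi" "x - c"] by (simp add: diff_add_eq)

lemma continuous_on_translate:
  "continuous_on UNIV f \<Longrightarrow> continuous_on UNIV (\<lambda>x::real. f (x - c))"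
  by (rule continuous_on_compose2) (auto intro: continuous_intros)

locale bifurcating_family =
  fixes i :: nat and a b \<delta> \<omega> :: real and g :: "real \<Rightarrow> real"
  assumes index: "i \<in> {1, 2, 3, 4}"
    and a_gt: "i \<in> {1, 2, 3} \<Longrightarrow> a > 1" and a_lt: "i = 4 \<Longrightarrow> a < -1"
    and delta: "\<delta> > 0"
    and g_circle: "circle_fun g" and g_cont: "continuous_on UNIV g"
    and bstar: "bifurcation_value i a \<delta> \<omega> g b"
begin

abbreviation N where "N \<equiv> twisted_sum a \<omega> g"
abbreviation l where "l \<equiv> lam i a \<delta> \<omega> g b"

text \<open>The constant term of \<open>l 0\<close>. For \<open>i = 2\<close> it is the fixed point
  of \<open>x \<mapsto> a * (x - \<delta>)\<close>.\<close>

definition K :: real where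
  "K = (if i = 1 then pi / 2 else if i = 2 then a * \<delta> / (a - 1) else 1)"

definition \<alpha> :: real where "\<alpha> = (if i = 4 then a\<^sup>2 else a)"
definition \<rho> :: real where "\<rho> = (if i = 4 then 2 * \<omega> else \<omega>)"

lemma alpha_rho_simps:
  "i = 4 \<Longrightarrow> \<alpha> = a\<^sup>2" "i \<noteq> 4 \<Longrightarrow> \<alpha> = a" "i = 4 \<Longrightarrow> \<rho> = 2 * \<omega>" "i \<noteq> 4 \<Longrightarrow> \<rho> = \<omega>"
  unfolding \<alpha>_def \<rho>_def by simp_all

lemma abs_a: "\<bar>a\<bar> > 1"
  using index a_gt a_lt by auto

lemma alpha: "\<alpha> > 1"
proof (cases "i = 4")
  case True
  have "1 < \<bar>a\<bar>\<^sup>2" using abs_a by (intro one_less_power) auto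
  then show ?thesis unfolding alpha_rho_simps(1)[OF True] by simp
next
  case False
  then show ?thesis unfolding alpha_rho_simps(2)[OF False] using index a_gt by auto
qed

lemma K_pos: "K > 0"
  using a_gt delta by (auto simp: K_def)

lemmas N_shift = twisted_sum_shift[OF abs_a g_circle g_cont, of \<omega>]

lemma N_eq: "N \<theta> = a * N (\<theta> - \<omega>) + g (\<theta> - \<omega>)"
  using N_shift[of "\<theta> - \<omega>"] by simp

section \<open>Explicit form of the invariant curves and of the initial gap\<close>

lemma mu_eq: "mu i a \<delta> \<omega> g b' \<theta> = (if i = 2 then a * \<delta> / (a - 1) else 0) + sgm i * b' * N \<theta>"
proof -
  have "mu i a \<delta> \<omega> g b' = cont_solution \<omega> (\<lambda>\<theta> x. a * x + (if i = 2 then - (a * \<delta>) else 0) + sgm i * b' * g \<theta>)"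
    unfolding mu_def by (rule arg_cong[of _ _ "cont_solution \<omega>"]) (auto simp: fun_eq_iff algebra_simps)
  then show ?thesis
    using abs_a unfolding cont_solution_affine[OF abs_a g_circle g_cont] by (auto simp: field_simps)
qed

text \<open>The forcing term of \<open>phi0\<close> cancels against the one in \<open>N_eq\<close>.
  The parameter \<open>b'\<close> stays free because minimality of \<open>b\<close> compares
  different parameters.\<close>

lemma lam_zero_gen: "lam i a \<delta> \<omega> g b' 0 \<theta> = K + a * b' * N (\<theta> - \<omega>)"
  using index unfolding lam_def mu_eq phi.simps phi0_def sgm_def K_def N_eq[of \<theta>]
  by (auto simp: algebra_simps)

lemma lam_zero: "l 0 (\<theta> + \<omega>) = K + a * b * N \<theta>"
  unfolding lam_zero_gen by simp

section \<open>Consequences of the minimality of \<open>b\<close>\<close>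

lemma b_pos: "b > 0"
  using bstar unfolding bifurcation_value_def by blast

lemma bif_meetI:
  assumes "K + a * b' * N \<theta> = 0"
  shows "bif_meet i a \<delta> \<omega> g b'"
proof -
  have "lam i a \<delta> \<omega> g b' 0 (\<theta> + \<omega>) = 0" unfolding lam_zero_gen using assms by simp
  then have "phi0 i \<omega> g b' (\<theta> + \<omega>) = mu i a \<delta> \<omega> g b' (\<theta> + \<omega>)"
    unfolding lam_def phi.simps by (simp split: if_splits)
  then show ?thesis unfolding bif_meet_def graphs_meet_def by blast
qed

lemma bif_meetI1:
  assumes "i = 1" "- K + a * b' * N \<theta> = 0"
  shows "bif_meet i a \<delta> \<omega> g b'"
proof -
  have "gamma_tilde1 \<omega> g b' (\<theta> + \<omega>) = mu i a \<delta> \<omega> g b' (\<theta> + \<omega>)"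
    using assms unfolding gamma_tilde1_def mu_eq sgm_def K_def N_shift by (simp add: algebra_simps)
  then show ?thesis using assms unfolding bif_meet_def graphs_meet_def by blast
qed

text \<open>The curves meet at parameter \<open>b'\<close> where an expression affine in \<open>b'\<close> vanishes, so a
  negative value at \<open>b\<close> would produce a meeting at a smaller parameter.\<close>

lemma affine_nonneg:
  assumes meet: "\<And>b'. K + b' * x = 0 \<Longrightarrow> bif_meet i a \<delta> \<omega> g b'"
  shows "K + b * x \<ge> 0"
proof (rule ccontr)
  assume neg: "\<not> K + b * x \<ge> 0"
  then have "b * x < 0" using K_pos by simp
  then have "x < 0" using b_pos by (simp add: mult_less_0_iff)
  then have "K + (- K / x) * x = 0" by simp
  then have "bif_meet i a \<delta> \<omega> g (- K / x)" by (rule meet)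
  moreover have "0 < - K / x" "- K / x < b" using \<open>x < 0\<close> K_pos neg by (auto simp: field_simps)
  moreover have "0 < b' \<and> bif_meet i a \<delta> \<omega> g b' \<Longrightarrow> b \<le> b'" for b'
    using bstar unfolding bifurcation_value_def by blast
  ultimately show False by (meson not_le)
qed

lemma lam_zero_nonneg: "0 \<le> l 0 \<theta>"
  using affine_nonneg[of "a * N (\<theta> - \<omega>)"] bif_meetI[of _ "\<theta> - \<omega>"]
  unfolding lam_zero_gen by (simp add: mult_ac)

text \<open>The analogue of \<open>lam_zero_nonneg\<close> for the lower curve
  \<open>gamma_tilde1\<close>. It keeps the invariant curve out of the lower plateau of
  \<open>h1\<close>.\<close>

lemma i1_upper:
  assumes "i = 1"
  shows "a * b * N \<theta> \<le> pi / 2"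
proof -
  have "K = pi / 2" unfolding K_def using assms by simp
  moreover have "0 \<le> K + b * - (a * N \<theta>)"
    by (rule affine_nonneg, rule bif_meetI1[OF assms, of _ \<theta>]) (simp add: algebra_simps)
  ultimately show ?thesis by (simp add: mult_ac)
qed

section \<open>The piecewise affine maps in max-min form\<close>

text \<open>Written with \<open>max\<close> and \<open>min\<close>, the four maps are visibly
  continuous, and the recursion for the gaps becomes a matter of elementary inequalities.\<close>

lemma h1_eq: "a > 0 \<Longrightarrow> h1 a x = max (- (pi / 2)) (min (pi / 2) (a * x))"
proof -
  assume "a > 0"
  then have eq: "x < - (pi / (2 * a)) \<longleftrightarrow> a * x < - (pi / 2)" "x \<le> pi / (2 * a) \<longleftrightarrow> a * x \<le> pi / 2"
    by (simp_all add: field_simps)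
  consider "a * x < - (pi / 2)" | "- (pi / 2) \<le> a * x" "a * x \<le> pi / 2" | "pi / 2 < a * x" by linarith
  then show ?thesis
    using pi_gt_zero unfolding h1_def eq by cases (simp add: max_def min_def; use pi_gt_zero in linarith)+
qed

lemma h2_eq: "a > 0 \<Longrightarrow> h2 a \<delta> x = max (a * (x - \<delta>)) 0 + min (a * (x + \<delta>)) 0"
proof -
  assume "a > 0"
  consider "x < - \<delta>" | "- \<delta> \<le> x" "x \<le> \<delta>" | "\<delta> < x" by linarith
  then show ?thesis
  proof cases
    case 1
    then have "a * (x - \<delta>) \<le> 0" "a * (x + \<delta>) \<le> 0"
      using \<open>a > 0\<close> delta by (auto intro!: mult_nonneg_nonpos)
    then show ?thesis using 1 by (simp add: h2_def)
  next
    case 2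
    then have "a * (x - \<delta>) \<le> 0" "0 \<le> a * (x + \<delta>)"
      using \<open>a > 0\<close> by (auto intro!: mult_nonneg_nonpos mult_nonneg_nonneg)
    then show ?thesis using 2 by (simp add: h2_def)
  next
    case 3
    then have "0 \<le> a * (x - \<delta>)" "0 \<le> a * (x + \<delta>)"
      using \<open>a > 0\<close> delta by (auto intro!: mult_nonneg_nonneg)
    then show ?thesis using 3 delta by (simp add: h2_def)
  qed
qed

lemma h3_eq: "a > 0 \<Longrightarrow> h3 a x = max (a * x) (- 1)"
proof -
  assume "a > 0"
  then have "- (1 / a) < x \<longleftrightarrow> - 1 < a * x" by (simp add: field_simps)
  then show ?thesis by (simp add: h3_def max_def)
qed

lemma h4_eq: "a < 0 \<Longrightarrow> h4 a x = min (a * x) 1"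
  by (auto simp: h4_def min_def field_simps)

lemma h_cont: "continuous_on UNIV (h i a \<delta>)"
proof -
  consider "i = 1" | "i = 2" | "i = 3" | "i = 4" using index by auto
  then show ?thesis
  proof cases
    case 1
    then have "h i a \<delta> = (\<lambda>x. max (- (pi / 2)) (min (pi / 2) (a * x)))"
      using a_gt by (simp add: h_def h1_eq fun_eq_iff)
    then show ?thesis by (simp only:) (intro continuous_intros)
  next
    case 2
    then have "h i a \<delta> = (\<lambda>x. max (a * (x - \<delta>)) 0 + min (a * (x + \<delta>)) 0)"
      using a_gt by (simp add: h_def h2_eq fun_eq_iff)
    then show ?thesis by (simp only:) (intro continuous_intros)
  next
    case 3
    then have "h i a \<delta> = (\<lambda>x. max (a * x) (- 1))"
      using a_gt by (simp add: h_def h3_eq fun_eq_iff)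
    then show ?thesis by (simp only:) (intro continuous_intros)
  next
    case 4
    then have "h i a \<delta> = (\<lambda>x. min (a * x) 1)"
      using a_lt by (simp add: h_def h4_eq fun_eq_iff)
    then show ?thesis by (simp only:) (intro continuous_intros)
  qed
qed

section \<open>Continuity and periodicity of the iterated curves\<close>

lemma graph_transform_eq:
  "graph_transform i a \<delta> \<omega> g b f \<theta> = h i a \<delta> (f (\<theta> - \<omega>)) + sgm i * b * g (\<theta> - \<omega>)"
  by (simp add: graph_transform_def skew_map_def)

lemma graph_transform_cont_circle:
  assumes "continuous_on UNIV f" "circle_fun f"
  shows "continuous_on UNIV (graph_transform i a \<delta> \<omega> g b f)" "circle_fun (graph_transform i a \<delta> \<omega> g b f)"
proof -
  show "continuous_on UNIV (graph_transform i a \<delta> \<omega> g b f)"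
  proof -
    have "continuous_on UNIV (\<lambda>\<theta>. f (\<theta> - \<omega>))" "continuous_on UNIV (\<lambda>\<theta>. g (\<theta> - \<omega>))"
      by (rule continuous_on_translate assms(1) g_cont)+
    moreover from this(1) have "continuous_on UNIV (\<lambda>\<theta>. h i a \<delta> (f (\<theta> - \<omega>)))"
      by (rule continuous_on_compose2[OF h_cont]) simp
    ultimately show ?thesis
      unfolding graph_transform_eq[abs_def] by (intro continuous_on_add continuous_on_mult_left)
  qed
  show "circle_fun (graph_transform i a \<delta> \<omega> g b f)"
    by (rule periodic_fun_simple.intro)
      (simp only: graph_transform_eq circle_fun_translate[OF assms(2)] circle_fun_translate[OF g_circle])
qed

lemma phi_cont_circle:
  "continuous_on UNIV (phi i a \<delta> \<omega> g b n) \<and> circle_fun (phi i a \<delta> \<omega> g b n)"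
proof (induction n)
  case 0
  have g': "continuous_on UNIV (\<lambda>\<theta>. g (\<theta> - \<omega>))"
    by (rule continuous_on_translate[OF g_cont])
  then have "continuous_on UNIV (phi0 i \<omega> g b)"
    using index by (auto simp: phi0_def[abs_def] intro!: continuous_intros)
  moreover have "circle_fun (phi0 i \<omega> g b)"
    by (rule periodic_fun_simple.intro) (simp only: phi0_def circle_fun_translate[OF g_circle])
  ultimately show ?case by simp
next
  case (Suc n)
  show ?case
  proof (cases "i = 4")
    case True
    show ?thesis unfolding phi.simps if_P[OF True] using Suc graph_transform_cont_circle by blast
  next
    case False
    show ?thesis unfolding phi.simps if_not_P[OF False] using Suc graph_transform_cont_circle by blast
  qed
qed

lemma lam_cont: "continuous_on UNIV (l n)"
proof -
  have "continuous_on UNIV (mu i a \<delta> \<omega> g b)"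
    unfolding mu_eq[abs_def] using twisted_sum_continuous[OF abs_a g_circle g_cont]
    by (intro continuous_intros) auto
  then show ?thesis
    unfolding lam_def[abs_def] using phi_cont_circle[of n]
    by (cases "i = 2 \<or> i = 3") (auto intro!: continuous_on_diff)
qed

lemma lam_circle: "circle_fun (l n)"
  by (rule periodic_fun_simple.intro)
    (simp only: lam_def mu_eq periodic_fun_simple.plus_period[OF phi_cont_circle[of n, THEN conjunct2]]
      periodic_fun_simple.plus_period[OF twisted_sum_circle[OF abs_a g_circle g_cont, of \<omega>]])

section \<open>The recursion for the gaps\<close>

lemma mu_shift:
  "mu i a \<delta> \<omega> g b (\<theta> + \<omega>) = a * mu i a \<delta> \<omega> g b \<theta> - (if i = 2 then a * \<delta> else 0) + sgm i * b * g \<theta>"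
  using a_gt unfolding mu_eq N_shift by (auto simp: field_simps)

text \<open>Reading \<open>l 0\<close> one rotation later through \<open>mu\<close> puts it in the
  same terms as the next gap, and turns its nonnegativity into a bound placing \<open>mu\<close> on
  the right affine piece.\<close>

lemma lam_zero_mu:
  "l 0 (\<theta> + \<omega>) = (if i = 1 then pi / 2 - a * mu i a \<delta> \<omega> g b \<theta>
     else if i = 2 then a * (mu i a \<delta> \<omega> g b \<theta> - \<delta>)
     else if i = 3 then a * mu i a \<delta> \<omega> g b \<theta> + 1 else 1 - a * mu i a \<delta> \<omega> g b \<theta>)"
  using index unfolding lam_def mu_shift phi.simps phi0_def sgm_def by (auto simp: algebra_simps)

lemma phi_Suc_shift:
  "i \<noteq> 4 \<Longrightarrow> phi i a \<delta> \<omega> g b (Suc n) (\<theta> + \<omega>) = h i a \<delta> (phi i a \<delta> \<omega> g b n \<theta>) + sgm i * b * g \<theta>"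
  by (simp add: graph_transform_eq)

text \<open>On the linear branch the gap is multiplied by the slope; on the plateau the image lies
  on the initial curve, so the gap is reset to \<open>l 0\<close>. The \<open>min\<close> records
  which branch applies.\<close>

lemma lam_Suc_shift:
  assumes nonneg: "0 \<le> l n \<theta>" and "i \<noteq> 2"
  shows "l (Suc n) (\<theta> + \<rho>) = min (\<alpha> * l n \<theta>) (l 0 (\<theta> + \<rho>))"
proof -
  consider "i = 1" | "i = 3" | "i = 4" using index \<open>i \<noteq> 2\<close> by auto
  then show ?thesis
  proof cases
    case 1
    define p u where "p = phi i a \<delta> \<omega> g b n \<theta>" and "u = mu i a \<delta> \<omega> g b \<theta>"
    have a0: "a > 0" using a_gt 1 by simp
    have l: "l n \<theta> = p - u" using 1 by (simp add: lam_def p_def u_def)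
    then have "a * u \<le> a * p" using nonneg a0 by simp
    moreover have "a * u = - (a * b * N \<theta>)" unfolding u_def mu_eq sgm_def using 1 by simp
    \<comment> \<open>As \<open>a * u \<le> a * p\<close>, the lower plateau of \<open>h1\<close>
      has no effect at \<open>p\<close>.\<close>
    then have "- (pi / 2) \<le> a * u" using i1_upper[OF 1, of \<theta>] by linarith
    moreover have "a * u \<le> pi / 2"
      using lam_zero_nonneg[of "\<theta> + \<omega>"] 1 unfolding lam_zero_mu by (simp add: u_def)
    moreover have Suc: "l (Suc n) (\<theta> + \<omega>) = h1 a p - a * u"
      unfolding lam_def mu_shift h_def p_def u_def
      using 1 phi_Suc_shift[of n \<theta>] by (simp add: h_def)
    moreover have zero: "l 0 (\<theta> + \<omega>) = pi / 2 - a * u"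
      unfolding lam_zero_mu u_def using 1 by simp
    moreover have rho: "\<rho> = \<omega>" and alpha: "\<alpha> = a" using 1 alpha_rho_simps by auto
    ultimately show ?thesis
      unfolding rho alpha l Suc zero h1_eq[OF a0] right_diff_distrib by linarith
  next
    case 2
    define p u where "p = phi i a \<delta> \<omega> g b n \<theta>" and "u = mu i a \<delta> \<omega> g b \<theta>"
    have a0: "a > 0" using a_gt 2 by simp
    have l: "l n \<theta> = u - p" using 2 by (simp add: lam_def p_def u_def)
    have Suc: "l (Suc n) (\<theta> + \<omega>) = a * u - h3 a p"
      unfolding lam_def mu_shift h_def p_def u_def
      using 2 phi_Suc_shift[of n \<theta>] by (simp add: h_def)
    have zero: "l 0 (\<theta> + \<omega>) = a * u + 1" unfolding lam_zero_mu u_def using 2 by simp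
    have rho: "\<rho> = \<omega>" and alpha: "\<alpha> = a" using 2 alpha_rho_simps by auto
    show ?thesis
      unfolding rho alpha l Suc zero h3_eq[OF a0] right_diff_distrib by linarith
  next
    case 3
    define f where "f = graph_transform i a \<delta> \<omega> g b (phi i a \<delta> \<omega> g b n)"
    have a0: "a < 0" using a_lt 3 by simp
    have step: "graph_transform i a \<delta> \<omega> g b v (\<theta>' + \<omega>) - mu i a \<delta> \<omega> g b (\<theta>' + \<omega>) =
        min (a * (v \<theta>' - mu i a \<delta> \<omega> g b \<theta>')) (l 0 (\<theta>' + \<omega>))" for v \<theta>'
      using 3 unfolding graph_transform_eq mu_shift lam_zero_mu h_def
      by (auto simp: h4_eq[OF a0] min_def algebra_simps)
    \<comment> \<open>The negative slope makes the gap nonpositive after one application, so the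
      first minimum is always the linear term. Only the second application can meet the
      plateau.\<close>
    have "a * l n \<theta> \<le> 0" using a0 nonneg by (simp add: mult_nonpos_nonneg)
    then have "f (\<theta> + \<omega>) - mu i a \<delta> \<omega> g b (\<theta> + \<omega>) = a * l n \<theta>"
      unfolding f_def step using 3 lam_zero_nonneg[of "\<theta> + \<omega>"] by (simp add: lam_def)
    moreover have "l (Suc n) (\<theta> + \<omega> + \<omega>) = graph_transform i a \<delta> \<omega> g b f (\<theta> + \<omega> + \<omega>) - mu i a \<delta> \<omega> g b (\<theta> + \<omega> + \<omega>)"
      using 3 by (simp add: lam_def f_def)
    ultimately show ?thesis
      unfolding step alpha_rho_simps(1,3)[OF 3] by (simp add: power2_eq_square mult.assoc add.assoc)
  qed
qed

text \<open>The lower branch adds the nonpositive term \<open>min (a * (p + \<delta>)) 0\<close> to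
  the new curve, which can only widen the gap; hence an inequality, with the transport of zeros
  proved separately.\<close>

lemma lam_Suc_shift_2:
  assumes "i = 2"
  shows "l (Suc n) (\<theta> + \<rho>) \<ge> min (\<alpha> * l n \<theta>) (l 0 (\<theta> + \<rho>))"
    and "l n \<theta> = 0 \<Longrightarrow> l (Suc n) (\<theta> + \<rho>) = 0"
proof -
  define p u where "p = phi i a \<delta> \<omega> g b n \<theta>" and "u = mu i a \<delta> \<omega> g b \<theta>"
  have a0: "a > 0" using a_gt assms by simp
  have rho: "\<rho> = \<omega>" and alpha: "\<alpha> = a" using assms alpha_rho_simps by auto
  have l: "l n \<theta> = u - p" using assms by (simp add: lam_def p_def u_def)
  have Suc: "l (Suc n) (\<theta> + \<rho>) = a * (u - \<delta>) - h2 a \<delta> p"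
    using assms phi_Suc_shift[of n \<theta>] unfolding rho lam_def mu_shift p_def u_def h_def
    by (simp add: right_diff_distrib h_def)
  have zero: "l 0 (\<theta> + \<rho>) = a * (u - \<delta>)" unfolding rho lam_zero_mu u_def using assms by simp
  show "l (Suc n) (\<theta> + \<rho>) \<ge> min (\<alpha> * l n \<theta>) (l 0 (\<theta> + \<rho>))"
    unfolding Suc zero l h2_eq[OF a0] alpha by (auto simp: max_def min_def algebra_simps)
  \<comment> \<open>Where the gap is zero, \<open>p = u\<close> lies on the closed upper branch, on
    which \<open>h2\<close> agrees with the affine map defining \<open>mu\<close>.\<close>
  have "u \<ge> \<delta>" using lam_zero_nonneg[of "\<theta> + \<rho>"] a0 unfolding zero by (simp add: zero_le_mult_iff)
  then show "l (Suc n) (\<theta> + \<rho>) = 0" if "l n \<theta> = 0"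
    using that delta unfolding Suc l by (auto simp: h2_def)
qed

lemma lam_Suc_ge: "0 \<le> l n \<theta> \<Longrightarrow> l (Suc n) (\<theta> + \<rho>) \<ge> min (\<alpha> * l n \<theta>) (l 0 (\<theta> + \<rho>))"
  using lam_Suc_shift lam_Suc_shift_2(1) by (cases "i = 2") auto

lemma lam_nonneg: "0 \<le> l n \<theta>"
proof (induction n arbitrary: \<theta>)
  case 0
  then show ?case by (rule lam_zero_nonneg)
next
  case (Suc n)
  have "0 \<le> min (\<alpha> * l n (\<theta> - \<rho>)) (l 0 \<theta>)" using Suc alpha lam_zero_nonneg by simp
  also have "\<dots> \<le> l (Suc n) \<theta>" using lam_Suc_ge[OF Suc, of "\<theta> - \<rho>"] by simp
  finally show ?case .
qed

lemma lam_orbit_zero: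
  assumes "l 0 \<zeta> = 0"
  shows "l n (\<zeta> + real n * \<rho>) = 0"
proof (induction n)
  case (Suc n)
  have "l (Suc n) (\<zeta> + real n * \<rho> + \<rho>) = 0"
    using Suc lam_Suc_shift_2(2)[OF _ Suc] lam_Suc_shift[of n "\<zeta> + real n * \<rho>"] lam_zero_nonneg
    by (cases "i = 2") (auto simp: min_def)
  then show ?case by (simp add: algebra_simps)
qed (use assms in simp)

section \<open>Convergence of the gaps and their lower bound\<close>

text \<open>The first gap is a minimum involving \<open>l 0\<close>, and the recursion is monotone
  in the previous gap, so the decrease propagates.\<close>

lemma lam_Suc_le: "i \<noteq> 2 \<Longrightarrow> l (Suc n) \<theta> \<le> l n \<theta>"
proof (induction n arbitrary: \<theta>)
  case 0
  then show ?case using lam_Suc_shift[OF lam_nonneg, of 0 "\<theta> - \<rho>"] by simp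
next
  case (Suc n)
  have "l (Suc (Suc n)) \<theta> = min (\<alpha> * l (Suc n) (\<theta> - \<rho>)) (l 0 \<theta>)"
    "l (Suc n) \<theta> = min (\<alpha> * l n (\<theta> - \<rho>)) (l 0 \<theta>)"
    using lam_Suc_shift[OF lam_nonneg Suc.prems, of _ "\<theta> - \<rho>"] by simp_all
  moreover have "\<alpha> * l (Suc n) (\<theta> - \<rho>) \<le> \<alpha> * l n (\<theta> - \<rho>)"
    using Suc alpha by (intro mult_left_mono) auto
  ultimately show ?case by (auto simp: min_def)
qed

text \<open>Decreasing and nonnegative for \<open>i \<noteq> 2\<close>. For \<open>i = 2\<close> the
  recursion is only an inequality, and convergence of the curves is taken from the assumption that
  the pointwise limit exists.\<close>

lemma lam_convergent:
  assumes "i = 2 \<Longrightarrow> \<forall>\<theta>. convergent (\<lambda>n. phi i a \<delta> \<omega> g b n \<theta>)"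
  shows "convergent (\<lambda>n. l n \<theta>)"
proof (cases "i = 2")
  case True
  then have "convergent (\<lambda>n. mu i a \<delta> \<omega> g b \<theta> - phi i a \<delta> \<omega> g b n \<theta>)"
    using assms by (intro convergent_diff convergent_const) simp
  then show ?thesis using True by (simp add: lam_def)
next
  case False
  then have "decseq (\<lambda>n. l n \<theta>)" by (intro decseq_SucI lam_Suc_le)
  then obtain L where "(\<lambda>n. l n \<theta>) \<longlonglongrightarrow> L"
    by (rule decseq_convergent[where B = 0]) (auto intro: lam_nonneg)
  then show ?thesis by (rule convergentI)
qed

text \<open>Unrolls the \<open>min\<close> recursion along the backward orbit. The constant must
  vary in the induction: a step back replaces \<open>c\<close> by
  \<open>c / \<alpha>\<close>.\<close>

lemma lam_lower_bound:
  assumes "\<And>k. c \<le> \<alpha> ^ k * l 0 (\<theta> - real k * \<rho>)"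
  shows "c \<le> l n \<theta>"
  using assms
proof (induction n arbitrary: \<theta> c)
  case 0
  then show ?case using 0[of 0] by simp
next
  case (Suc n)
  have "c / \<alpha> \<le> l n (\<theta> - \<rho>)"
  proof (rule Suc.IH)
    fix k
    show "c / \<alpha> \<le> \<alpha> ^ k * l 0 (\<theta> - \<rho> - real k * \<rho>)"
      using Suc.prems[of "Suc k"] alpha by (simp add: pos_divide_le_eq algebra_simps)
  qed
  then have "c \<le> \<alpha> * l n (\<theta> - \<rho>)" using alpha by (simp add: pos_divide_le_eq mult.commute)
  moreover have "c \<le> l 0 \<theta>" using Suc.prems[of 0] by simp
  ultimately show ?case using lam_Suc_ge[OF lam_nonneg, of n "\<theta> - \<rho>"] by simp
qed

section \<open>Finite order of the zeros of \<open>l 0\<close> and the null set\<close>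

lemma rho_irrational: "\<omega> / (2 * pi) \<notin> \<rat> \<Longrightarrow> \<rho> / (2 * pi) \<notin> \<rat>"
proof (cases "i = 4")
  case True
  assume "\<omega> / (2 * pi) \<notin> \<rat>"
  moreover have "\<omega> / (2 * pi) = (\<rho> / (2 * pi)) / 2" unfolding alpha_rho_simps(3)[OF True] by simp
  ultimately show ?thesis by (metis Rats_divide Rats_number_of)
qed (simp add: alpha_rho_simps)

text \<open>A vanishing \<open>l 0\<close> makes \<open>N\<close> constant, and then the equation
  for \<open>N\<close> makes \<open>g\<close> constant. This supplies the nonzero point required in
  the analytic case.\<close>

lemma lam_zero_not_null:
  assumes "\<exists>\<theta> \<eta>. g \<theta> \<noteq> g \<eta>"
  shows "\<exists>\<theta>. l 0 \<theta> \<noteq> 0"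
proof (rule ccontr)
  assume "\<not> ?thesis"
  then have "a * b * N \<theta> = - K" for \<theta> using lam_zero[of \<theta>] by (simp add: eq_neg_iff_add_eq_0 add.commute)
  then have N: "N \<theta> = - K / (a * b)" for \<theta> using abs_a b_pos by (auto simp: field_simps)
  have "g \<theta> = - K / (a * b) - a * (- K / (a * b))" for \<theta>
    using N_shift[of \<theta>] unfolding N by linarith
  then show False using assms by metis
qed

lemma lam_zero_finite_order:
  assumes nonconst: "\<exists>\<theta> \<eta>. g \<theta> \<noteq> g \<eta>"
    and A_or_B: "real_analytic g \<or> even_order_zeros (l 0)"
  shows "finite_order_zeros (l 0)"
  using A_or_B
proof
  assume an: "real_analytic g"
  obtain x0 where x0: "l 0 x0 \<noteq> 0" using lam_zero_not_null[OF nonconst] by blast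
  show ?thesis
  proof (rule finite_order_zerosI_holo_ext[where f = "l 0" and ?x0.0 = x0, OF _ x0])
    fix p
    have "\<exists>r G. holo_ext N (p - \<omega>) r G"
      unfolding twisted_sum_def[abs_def]
      by (rule holo_ext_series_of_shifts[OF an g_circle twisted_sum_summable_weights[OF abs_a]])
    then obtain r G where "holo_ext N (p - \<omega>) r G" by blast
    from holo_ext_affine[OF this, of K "a * b"]
    show "\<exists>r G. holo_ext (l 0) p r G"
      unfolding lam_zero_gen[abs_def] by blast
  qed
qed (rule finite_order_zerosI_even_order)

text \<open>A positive bound along the weighted backward orbit survives in the limit, so every zero
  of the limit is exceptional for Borel-Cantelli.\<close>

lemma lam_inf_zero_null:
  assumes fin: "finite_order_zeros (l 0)" and conv: "\<And>\<theta>. convergent (\<lambda>n. l n \<theta>)"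
  shows "negligible ({0..<2 * pi} \<inter> {\<theta>. lim (\<lambda>n. l n \<theta>) = 0})"
proof (rule negligible_subset)
  show "negligible ({0..<2 * pi} \<inter> {\<theta>. \<not> (\<exists>c>0. \<forall>k::nat. c \<le> \<alpha> ^ k * \<bar>l 0 (\<theta> - real k * \<rho>)\<bar>)})"
    by (rule negligible_no_uniform_bound[OF lam_cont lam_circle fin alpha])
  have "\<not> (\<exists>c>0. \<forall>k::nat. c \<le> \<alpha> ^ k * \<bar>l 0 (\<theta> - real k * \<rho>)\<bar>)"
    if lim: "lim (\<lambda>n. l n \<theta>) = 0" for \<theta>
  proof
    assume "\<exists>c>0. \<forall>k::nat. c \<le> \<alpha> ^ k * \<bar>l 0 (\<theta> - real k * \<rho>)\<bar>"
    then obtain c where c: "c > 0" "\<And>k. c \<le> \<alpha> ^ k * l 0 (\<theta> - real k * \<rho>)"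
      using lam_zero_nonneg by auto
    have "(\<lambda>n. l n \<theta>) \<longlonglongrightarrow> 0" using conv[of \<theta>] lim by (simp add: convergent_LIMSEQ_iff)
    then have "c \<le> 0" by (rule LIMSEQ_le_const) (use lam_lower_bound[OF c(2)] in blast)
    then show False using c(1) by simp
  qed
  then show "{0..<2 * pi} \<inter> {\<theta>. lim (\<lambda>n. l n \<theta>) = 0} \<subseteq>
      {0..<2 * pi} \<inter> {\<theta>. \<not> (\<exists>c>0. \<forall>k::nat. c \<le> \<alpha> ^ k * \<bar>l 0 (\<theta> - real k * \<rho>)\<bar>)}"
    by blast
qed

end

section \<open>Residuality and measure zero\<close>

text \<open>Constant \<open>g\<close> has to be excluded: then \<open>l 0\<close> would be constant,
  touching would make it vanish identically, and \<open>A\<close> would be the whole circle.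
  Existence of the limit is assumed only for \<open>i = 2\<close>; in the other cases it follows
  from monotonicity.\<close>

theorem theorem3p4:
  fixes i :: nat and a b \<delta> \<omega> :: real and g :: "real \<Rightarrow> real"
  defines "A \<equiv> {\<theta>. lam_inf i a \<delta> \<omega> g b \<theta> = 0}"
  assumes index: "i \<in> {1, 2, 3, 4}"
    and a: "i \<in> {1, 2, 3} \<Longrightarrow> a > 1" "i = 4 \<Longrightarrow> a < -1"
    and delta: "\<delta> > 0"
    and irrational: "\<omega> / (2 * pi) \<notin> \<rat>"
    and g: "circle_fun g" "C1_Hoelder g"
    and nonconstant: "\<exists>\<theta> \<eta>. g \<theta> \<noteq> g \<eta>"
    and bstar: "bifurcation_value i a \<delta> \<omega> g b"
    and touching: "zero_set (lam i a \<delta> \<omega> g b 0) \<noteq> {}"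
    and A_or_B: "real_analytic g \<or> even_order_zeros (lam i a \<delta> \<omega> g b 0)"
    and limit_exists: "i = 2 \<Longrightarrow> \<forall>\<theta>. convergent (\<lambda>n. phi i a \<delta> \<omega> g b n \<theta>)"
  shows "residual_circle A \<and> null_circle A \<and>
    (\<exists>R. R \<subseteq> A \<and> residual_circle R \<and> (\<forall>\<theta>\<in>R. \<theta> + \<omega> \<in> R \<and> \<theta> - \<omega> \<in> R))"
proof -
  have g_cont: "continuous_on UNIV g"
    using g(2) DERIV_isCont unfolding C1_Hoelder_def by (metis continuous_at_imp_continuous_on)
  interpret bifurcating_family i a b \<delta> \<omega> g
    by (rule bifurcating_family.intro) (fact index a delta g(1) g_cont bstar)+
  obtain \<zeta> where "l 0 \<zeta> = 0" using touching unfolding zero_set_def by auto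
  then have orbit: "l n (\<zeta> + real n * \<rho>) = 0" for n by (rule lam_orbit_zero)
  have conv: "convergent (\<lambda>n. l n \<theta>)" for \<theta> using limit_exists by (rule lam_convergent)
  have A: "A = {\<theta>. lim (\<lambda>n. l n \<theta>) = 0}" unfolding A_def lam_inf_def ..
  have res: "residual_circle A"
    unfolding A by (rule residual_zero_set_lim[OF rho_irrational[OF irrational] lam_circle lam_cont orbit conv])
  have "negligible ({0..<2 * pi} \<inter> A)"
    unfolding A by (rule lam_inf_zero_null[OF lam_zero_finite_order[OF nonconstant A_or_B] conv])
  then have "null_circle A"
    using res unfolding null_circle_def residual_circle_def
    by (simp add: negligible_iff_null_sets Int_commute)
  then show ?thesis using res residual_invariant_core[OF res] by blast
qed

end
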